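(* Let $N,m,n\ge 1$ be integers and let $P=(p_{ij})\in M_{m,n}(\mathcal P_N)$ be an $m\times n$ matrix of complex polynomials in $z_1,\dots,z_N$. If $\|P\|_u<1$, then there exist positive definite matrix-valued functions $K_i:\mathbb D^N\times\mathbb D^N\to M_m$, $0\le i\le N$, whose components are polynomials (in $z_1,\dots,z_N,\overline{w_1},\dots,\overline{w_N}$), such that $$I_m-P(z)P(w)^*=K_0(z,w)+\sum_{i=1}^N(1-z_i\overline{w_i})K_i(z,w)$$ for all $z,w\in\mathbb D^N$.
   Context: $\mathbb D$ is the open unit disk in $\mathbb C$, and $\mathcal P_N$ is the algebra of complex polynomials in $N$ commuting variables $z_1,\dots,z_N$. $M_{m,n}(V)$ denotes the $m\times n$ matrices with entries in $V$; $M_m=M_{m,m}(\mathbb C)$, $I_m$ is the identity of $M_m$. A commuting $N$-tuple of strict contractions is a tuple $T=(T_1,\dots,T_N)$ of pairwise commuting bounded operators on a complex Hilbert space $\mathcal H$ with $\|T_i\|<1$ for each $i$. For $P=(p_{ij})\in M_{m,n}(\mathcal P_N)$, $P(T)=(p_{ij}(T))$ is regarded as an operator from the direct sum of $n$ copies of $\mathcal H$ to the direct sum of $m$ copies of $\mathcal H$, and $\|P\|_u=\sup\|P(T)\|$, the supremum being over all Hilbert spaces and all commuting $N$-tuples of strict contractions $T$. A function $K:\mathbb D^N\times\mathbb D^N\to M_m$ is called positive definite if for every choice of finitely many points $z^{(1)},\dots,z^{(r)}\in\mathbb D^N$ the block matrix $(K(z^{(a)},z^{(b)}))_{a,b=1}^r$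 is positive semidefinite. *)

theory Defs
  imports
    "HOL-Analysis.Analysis"
    "HOL-Algebra.Module"
    "HOL-Library.Poly_Mapping"
begin

subsection \<open>Polynomials\<close>

text \<open>A polynomial with complex coefficients and variables of type \<open>'v\<close> maps each exponent
  vector, with finitely many exceptions, to \<open>0\<close>. The operations that make this type a commutative
  ring are those of \<^theory>\<open>HOL-Library.Poly_Mapping\<close>.\<close>

type_synonym 'v cpoly = "('v \<Rightarrow>\<^sub>0 nat) \<Rightarrow>\<^sub>0 complex"

definition polys_in :: "'v set \<Rightarrow> 'v cpoly set" where
  "polys_in V = {p. \<forall>\<alpha>\<in>Poly_Mapping.keys p. Poly_Mapping.keys \<alpha> \<subseteq> V}"

definition eval_poly :: "'v cpoly \<Rightarrow> ('v \<Rightarrow> complex) \<Rightarrow> complex" where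
  "eval_poly p z = (\<Sum>\<alpha>\<in>Poly_Mapping.keys p. Poly_Mapping.lookup p \<alpha> *
      (\<Prod>v\<in>Poly_Mapping.keys \<alpha>. z v ^ Poly_Mapping.lookup \<alpha> v))"

definition eval_mat :: "'v cpoly^'n^'m \<Rightarrow> ('v \<Rightarrow> complex) \<Rightarrow> complex^'n^'m" where
  "eval_mat P z = map_matrix (\<lambda>p. eval_poly p z) P"

text \<open>Points of the polydisc are \<open>N\<close>-tuples indexed by \<open>{1..N}\<close>.\<close>

definition polydisc :: "nat \<Rightarrow> (nat \<Rightarrow> complex) set" where
  "polydisc N = {1..N} \<rightarrow>\<^sub>E ball 0 1"


subsection \<open>Complex Hilbert spaces\<close>

definition complex_ring :: "complex ring" where
  "complex_ring = \<lparr>carrier = UNIV, monoid.mult = (*), one = 1, zero = 0, add = (+)\<rparr>"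

record 'h inner_space = "(complex, 'h) module" +
  cinner :: "'h \<Rightarrow> 'h \<Rightarrow> complex"

definition hnorm :: "('h, 'e) inner_space_scheme \<Rightarrow> 'h \<Rightarrow> real" where
  "hnorm H x = sqrt (Re (cinner H x x))"

definition hdist :: "('h, 'e) inner_space_scheme \<Rightarrow> 'h \<Rightarrow> 'h \<Rightarrow> real" where
  "hdist H x y = hnorm H (x \<ominus>\<^bsub>H\<^esub> y)"

locale complex_hilbert_space = Module.module complex_ring H for H (structure) +
  assumes cinner_add_left:
      "\<lbrakk>x \<in> carrier H; y \<in> carrier H; z \<in> carrier H\<rbrakk> \<Longrightarrow>
        cinner H (x \<oplus> y) z = cinner H x z + cinner H y z"
    and cinner_smult_left:
      "\<lbrakk>x \<in> carrier H; y \<in> carrier H\<rbrakk> \<Longrightarrow> cinner H (c \<odot>\<^bsub>H\<^esub> x) y = c * cinner H x y"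
    and cinner_commute:
      "\<lbrakk>x \<in> carrier H; y \<in> carrier H\<rbrakk> \<Longrightarrow> cinner H y x = cnj (cinner H x y)"
    and cinner_pos:
      "\<lbrakk>x \<in> carrier H; x \<noteq> \<zero>\<^bsub>H\<^esub>\<rbrakk> \<Longrightarrow> 0 < Re (cinner H x x)"
    and complete: "Metric_space.mcomplete (carrier H) (hdist H)"


subsection \<open>Operators\<close>

definition linear_operator :: "('h, 'e) inner_space_scheme \<Rightarrow> ('h \<Rightarrow> 'h) \<Rightarrow> bool" where
  "linear_operator H A \<longleftrightarrow>
     A \<in> carrier H \<rightarrow> carrier H \<and>
     (\<forall>x\<in>carrier H. \<forall>y\<in>carrier H. A (x \<oplus>\<^bsub>H\<^esub> y) = A x \<oplus>\<^bsub>H\<^esub> A y) \<and>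
     (\<forall>c. \<forall>x\<in>carrier H. A (c \<odot>\<^bsub>H\<^esub> x) = c \<odot>\<^bsub>H\<^esub> A x)"

text \<open>The operator norm, for a map from \<open>X\<close> with norm \<open>nX\<close> to a space with norm \<open>nY\<close>; it is
  infinite if the map is unbounded.\<close>

definition op_norm :: "'x set \<Rightarrow> ('x \<Rightarrow> real) \<Rightarrow> ('y \<Rightarrow> real) \<Rightarrow> ('x \<Rightarrow> 'y) \<Rightarrow> ennreal" where
  "op_norm X nX nY A = (SUP x\<in>{x\<in>X. nX x \<le> 1}. ennreal (nY (A x)))"

definition commuting_strict_contractions ::
    "('h, 'e) inner_space_scheme \<Rightarrow> nat \<Rightarrow> (nat \<Rightarrow> 'h \<Rightarrow> 'h) \<Rightarrow> bool" where
  "commuting_strict_contractions H N T \<longleftrightarrow>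
     (\<forall>i\<in>{1..N}. linear_operator H (T i) \<and> op_norm (carrier H) (hnorm H) (hnorm H) (T i) < 1) \<and>
     (\<forall>i\<in>{1..N}. \<forall>j\<in>{1..N}. \<forall>x\<in>carrier H. T i (T j x) = T j (T i x))"

text \<open>\<open>T\<^sub>1\<^bsup>\<alpha>\<^sub>1\<^esup> \<circ> \<dots> \<circ> T\<^sub>N\<^bsup>\<alpha>\<^sub>N\<^esup>\<close>\<close>

definition monomial_op :: "nat \<Rightarrow> (nat \<Rightarrow> 'h \<Rightarrow> 'h) \<Rightarrow> (nat \<Rightarrow>\<^sub>0 nat) \<Rightarrow> 'h \<Rightarrow> 'h" where
  "monomial_op N T \<alpha> = foldr (\<lambda>i A. (T i ^^ Poly_Mapping.lookup \<alpha> i) \<circ> A) [1..<Suc N] id"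

definition poly_op ::
    "('h, 'e) inner_space_scheme \<Rightarrow> nat \<Rightarrow> (nat \<Rightarrow> 'h \<Rightarrow> 'h) \<Rightarrow> nat cpoly \<Rightarrow> 'h \<Rightarrow> 'h" where
  "poly_op H N T p x =
     (\<Oplus>\<^bsub>H\<^esub>\<alpha>\<in>Poly_Mapping.keys p. Poly_Mapping.lookup p \<alpha> \<odot>\<^bsub>H\<^esub> monomial_op N T \<alpha> x)"

text \<open>The direct sum of copies of \<open>H\<close> indexed by \<open>'n\<close> consists of the functions
  \<open>'n \<Rightarrow> 'h\<close> with values in the carrier.\<close>

definition dsum_carrier :: "('h, 'e) inner_space_scheme \<Rightarrow> ('n::finite \<Rightarrow> 'h) set" where
  "dsum_carrier H = UNIV \<rightarrow> carrier H"

definition dsum_norm :: "('h, 'e) inner_space_scheme \<Rightarrow> ('n::finite \<Rightarrow> 'h) \<Rightarrow> real" where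
  "dsum_norm H x = sqrt (\<Sum>j\<in>UNIV. (hnorm H (x j))\<^sup>2)"

definition polymat_op ::
    "('h, 'e) inner_space_scheme \<Rightarrow> nat \<Rightarrow> (nat \<Rightarrow> 'h \<Rightarrow> 'h) \<Rightarrow>
     nat cpoly^'n^'m \<Rightarrow> ('n::finite \<Rightarrow> 'h) \<Rightarrow> ('m::finite \<Rightarrow> 'h)" where
  "polymat_op H N T P x = (\<lambda>i. \<Oplus>\<^bsub>H\<^esub>j\<in>UNIV. poly_op H N T (P $ i $ j) (x j))"

text \<open>The supremum ranges over the Hilbert spaces whose underlying set is a subset of the type
  \<open>'h\<close>, with arbitrary operations. A supremum over the Hilbert spaces of all types is not a HOL
  term, but \<open>'h = (nat \<Rightarrow> complex)\<close> loses nothing. Given any Hilbert space, any \<open>T\<close> and any vector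
  \<open>x\<close> of the direct sum, the closed linear span of the vectors \<open>T\<^bsup>\<alpha>\<^esup> x\<^sub>j\<close> is a separable Hilbert space,
  it is invariant under \<open>T\<close>, and \<open>P(T) x\<close> has the same norm when computed in it. A separable Hilbert
  space has at most the cardinality of the continuum, so it is isomorphic to one whose underlying set
  is a subset of \<open>nat \<Rightarrow> complex\<close>.\<close>

definition universal_norm ::
    "'h itself \<Rightarrow> nat \<Rightarrow> nat cpoly^'n::finite^'m::finite \<Rightarrow> ennreal" where
  "universal_norm _ N P =
     Sup {op_norm (dsum_carrier H) (dsum_norm H) (dsum_norm H) (polymat_op H N T P)
          | (H :: 'h inner_space) T.
            complex_hilbert_space H \<and> commuting_strict_contractions H N T}"


subsection \<open>Positive definite matrix-valued functions\<close>

definition adjoint_mat :: "complex^'n^'m \<Rightarrow> complex^'m^'n" where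
  "adjoint_mat A = map_matrix cnj (transpose A)"

definition pos_semidef_on :: "'i set \<Rightarrow> ('i \<Rightarrow> 'i \<Rightarrow> complex) \<Rightarrow> bool" where
  "pos_semidef_on I M \<longleftrightarrow> (\<forall>v. (\<Sum>i\<in>I. \<Sum>j\<in>I. cnj (v i) * M i j * v j) \<in> \<real>\<^sub>\<ge>\<^sub>0)"

text \<open>The rows and columns of the block matrix are indexed by pairs of a point number \<open>a < r\<close> and a
  matrix index.\<close>

definition positive_definite_kernel ::
    "nat \<Rightarrow> ((nat \<Rightarrow> complex) \<Rightarrow> (nat \<Rightarrow> complex) \<Rightarrow> complex^'m::finite^'m) \<Rightarrow> bool" where
  "positive_definite_kernel N K \<longleftrightarrow>
     (\<forall>r. \<forall>z :: nat \<Rightarrow> nat \<Rightarrow> complex. (\<forall>a<r. z a \<in> polydisc N) \<longrightarrow>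
       pos_semidef_on ({..<r} \<times> UNIV) (\<lambda>(a, k) (b, l). K (z a) (z b) $ k $ l))"

text \<open>Polynomials in \<open>z\<^sub>1, \<dots>, z\<^sub>N\<close> (variables \<open>Inl i\<close>) and the conjugates of
  \<open>w\<^sub>1, \<dots>, w\<^sub>N\<close> (variables \<open>Inr i\<close>).\<close>

definition polynomial_kernel ::
    "nat \<Rightarrow> ((nat \<Rightarrow> complex) \<Rightarrow> (nat \<Rightarrow> complex) \<Rightarrow> complex^'m^'m) \<Rightarrow> bool" where
  "polynomial_kernel N K \<longleftrightarrow>
     (\<forall>k l. \<exists>q\<in>polys_in ({1..N} <+> {1..N}). \<forall>z\<in>polydisc N. \<forall>w\<in>polydisc N.
        K z w $ k $ l = eval_poly q (case_sum z (\<lambda>i. cnj (w i))))"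

end

theory Submission
  imports Defs "HOL-Library.Function_Algebras"
begin

text \<open>The kernels of the required form are a convex cone, and \<open>I\<close> is an order unit for it: every
  square \<open>p p\<^sup>*\<close> is bounded by a multiple of \<open>I\<close>, since a bound for \<open>p\<close> is also one for \<open>z\<^sub>i p\<close>.
  If \<open>I - P P\<^sup>*\<close> is not in the cone, a linear functional \<open>L\<close> that is nonnegative on the cone has
  \<open>L I = 1\<close> and \<open>L (P P\<^sup>*) \<ge> 1\<close>. The form \<open>F p q = L (p q\<^sup>*)\<close> makes vector polynomials a
  pre-Hilbert space on which multiplication by each variable is a contraction. The adjoints of these
  multiplications act on the bounded linear functionals, which Gram--Schmidt identifies with elements
  of \<open>\<ell>\<^sup>2\<close>. With \<open>T\<close> these adjoints times \<open>r < 1\<close> and \<open>x\<^sub>j\<close> the functional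
  \<open>p \<mapsto> F p P\<^sub>j\<close> for the \<open>j\<close>-th column \<open>P\<^sub>j\<close>, evaluating \<open>P(T) x\<close> on the unit vectors and letting \<open>r \<rightarrow> 1\<close>
  gives \<open>\<parallel>P\<parallel>\<^sub>u \<ge> 1\<close>.\<close>


subsection \<open>Separation from a cone with an order unit\<close>

text \<open>The cone is not known to be closed, so separation is only weak:
  \<open>f x \<le> 0\<close>. This suffices because the universal norm is assumed to be strictly
  below 1, whereas weak separation already forces it to be at least 1. Working with the cone itself
  and not with a closure is also what keeps the kernels polynomial. The multiplication operators
  would give the wrong matrix. The columns of \<open>P\<close> are obtained by evaluating the
  transpose of \<open>P\<close> at the multiplications and applying it to the unit vectors, so it is
  the transpose of \<open>P\<close> that gets norm at least 1. Passing to transposed operators on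
  the dual space restores \<open>P\<close>. Transposition is linear, hence the coefficients of
  \<open>P\<close> are not conjugated, and it reverses products, which is harmless for commuting
  operators. The dual has a second advantage. The form may vanish on nonzero vectors and its space
  need not be complete, but bounded functionals form a complete space anyway. Neither a quotient nor
  a completion has to be constructed, and coding the functionals by sequences places them in the
  type over which the universal norm is taken.\<close>

lemma order_unit_subspace:
  fixes scale :: "real \<Rightarrow> 'b::ab_group_add \<Rightarrow> 'b" (infixr \<open>\<cdot>\<close> 75)
  assumes vs: "vector_space scale"
    and C_add: "\<And>y z. y \<in> C \<Longrightarrow> z \<in> C \<Longrightarrow> y + z \<in> C"
    and C_scale: "\<And>r y. r \<ge> 0 \<Longrightarrow> y \<in> C \<Longrightarrow> r \<cdot> y \<in> C"
    and eC: "e \<in> C"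
  shows "module.subspace scale {y. \<exists>M. M \<cdot> e - y \<in> C \<and> M \<cdot> e + y \<in> C}"
    (is "module.subspace scale ?B")
proof -
  interpret vector_space scale by (rule vs)
  show ?thesis
  proof (rule subspaceI)
    show "0 \<in> ?B" using C_scale[of 0 e] eC by (auto intro!: exI[of _ 0])
  next
    fix y z assume "y \<in> ?B" "z \<in> ?B"
    then obtain M M' where M: "M \<cdot> e - y \<in> C" "M \<cdot> e + y \<in> C" "M' \<cdot> e - z \<in> C" "M' \<cdot> e + z \<in> C"
      by auto
    show "y + z \<in> ?B" using C_add[OF M(1,3)] C_add[OF M(2,4)]
      by (auto intro!: exI[of _ "M + M'"] simp: scale_left_distrib algebra_simps)
  next
    fix r y assume "y \<in> ?B"
    then obtain M where M: "M \<cdot> e - y \<in> C" "M \<cdot> e + y \<in> C" by auto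
    have "(\<bar>r\<bar> * M) \<cdot> e - r \<cdot> y \<in> C \<and> (\<bar>r\<bar> * M) \<cdot> e + r \<cdot> y \<in> C"
      using C_scale[OF _ M(1), of "\<bar>r\<bar>"] C_scale[OF _ M(2), of "\<bar>r\<bar>"]
      by (cases "r \<ge> 0") (auto simp: scale_right_distrib scale_right_diff_distrib)
    then show "r \<cdot> y \<in> ?B" by auto
  qed
qed

text \<open>\<open>C\<close> and \<open>- x\<close> are enlarged to a maximal cone \<open>D\<close>
  that omits \<open>- e\<close>. Maximality makes \<open>D\<close> total, and \<open>f y\<close> is
  the supremum of the \<open>r\<close> for which \<open>r \<cdot> e\<close> lies below
  \<open>y\<close> in the order given by \<open>D\<close>. On \<open>B\<close> this supremum is
  taken over a nonempty bounded set. The restriction to \<open>B\<close> matters in the application,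
  where the ambient space also contains non-hermitian kernels, which no multiple of \<open>e\<close>
  dominates.\<close>

lemma cone_separation:
  fixes scale :: "real \<Rightarrow> 'b::ab_group_add \<Rightarrow> 'b" (infixr \<open>\<cdot>\<close> 75)
  assumes vs: "vector_space scale"
    and C_add: "\<And>y z. y \<in> C \<Longrightarrow> z \<in> C \<Longrightarrow> y + z \<in> C"
    and C_scale: "\<And>r y. r \<ge> 0 \<Longrightarrow> y \<in> C \<Longrightarrow> r \<cdot> y \<in> C"
    and eC: "e \<in> C" and xC: "x \<notin> C"
    and B_def: "B = {y. \<exists>M. M \<cdot> e - y \<in> C \<and> M \<cdot> e + y \<in> C}"
    and xB: "x \<in> B"
  obtains f :: "'b \<Rightarrow> real" where
    "\<And>y z. y \<in> B \<Longrightarrow> z \<in> B \<Longrightarrow> f (y + z) = f y + f z"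
    "\<And>r y. y \<in> B \<Longrightarrow> f (r \<cdot> y) = r * f y"
    "\<And>y. y \<in> B \<Longrightarrow> y \<in> C \<Longrightarrow> 0 \<le> f y" "f e = 1" "f x \<le> 0"
proof -
  interpret vector_space scale by (rule vs)
  have zC: "0 \<in> C" using C_scale[of 0 e] eC by simp
  \<comment> \<open>Some \<open>M\<close> has \<open>M \<cdot> e + x\<close> in \<open>C\<close>. If
    \<open>- e\<close> were in \<open>C\<close>, the multiple of \<open>e\<close> could be
    subtracted again, and \<open>x\<close> itself would be in \<open>C\<close>.\<close>
  have meC: "- e \<notin> C"
  proof
    assume m: "- e \<in> C"
    obtain M where M: "M \<cdot> e + x \<in> C" using xB B_def by auto
    have "- (M \<cdot> e) \<in> C"
    proof (cases "M \<ge> 0")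
      case True then show ?thesis using C_scale[OF _ m, of M] by simp
    next
      case False then show ?thesis using C_scale[OF _ eC, of "-M"] by simp
    qed
    from C_add[OF this M] show False using xC by simp
  qed
  define cone where "cone = (\<lambda>D. (\<forall>y\<in>D. \<forall>z\<in>D. y + z \<in> D) \<and> (\<forall>r\<ge>0. \<forall>y\<in>D. r \<cdot> y \<in> D))"
  define A where "A = {D. C \<subseteq> D \<and> cone D \<and> - x \<in> D \<and> - e \<notin> D}"
  define ext where "ext = (\<lambda>D y. {d + t \<cdot> y | d t. d \<in> D \<and> t \<ge> 0})"
  have ext_cone: "cone (ext D y)" if "cone D" for D y
    unfolding cone_def
  proof (intro conjI ballI allI impI)
    fix p q assume "p \<in> ext D y" "q \<in> ext D y"
    then obtain d t d' t' where *: "p = d + t \<cdot> y" "q = d' + t' \<cdot> y" "d \<in> D" "d' \<in> D" "t \<ge> 0" "t' \<ge> 0"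
      unfolding ext_def by blast
    have "p + q = (d + d') + (t + t') \<cdot> y" using * by (simp add: scale_left_distrib)
    moreover have "d + d' \<in> D" using that * unfolding cone_def by blast
    ultimately show "p + q \<in> ext D y" unfolding ext_def using * by force
  next
    fix r :: real and p assume "r \<ge> 0" "p \<in> ext D y"
    then obtain d t where *: "p = d + t \<cdot> y" "d \<in> D" "t \<ge> 0"
      unfolding ext_def by blast
    have "r \<cdot> p = r \<cdot> d + (r * t) \<cdot> y" using * by (simp add: scale_right_distrib)
    moreover have "r \<cdot> d \<in> D" using that * \<open>r \<ge> 0\<close> unfolding cone_def by blast
    ultimately show "r \<cdot> p \<in> ext D y" unfolding ext_def using * \<open>r \<ge> 0\<close> by force
  qed
  have ext_sub: "D \<subseteq> ext D y" for D y
  proof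
    fix d assume "d \<in> D"
    then show "d \<in> ext D y" unfolding ext_def by (intro CollectI exI[of _ d] exI[of _ 0]) simp
  qed
  have ext_mem: "y \<in> ext D y" if "0 \<in> D" for D y
    unfolding ext_def using that by (intro CollectI exI[of _ 0] exI[of _ 1]) simp
  have coneC: "cone C" using C_add C_scale by (auto simp: cone_def)
  have "ext C (- x) \<in> A"
  proof -
    have "- e \<notin> ext C (- x)"
    proof
      assume "- e \<in> ext C (- x)"
      then obtain c t where ct: "c \<in> C" "t \<ge> 0" "- e = c - t \<cdot> x" unfolding ext_def by auto
      have "t \<noteq> 0" using ct meC by auto
      have "t \<cdot> x = c + e" using ct by (simp add: algebra_simps)
      then have "(1/t) \<cdot> (t \<cdot> x) \<in> C" using C_scale[OF _ C_add[OF ct(1) eC], of "1/t"] ct(2) by simp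
      then show False using \<open>t \<noteq> 0\<close> xC by simp
    qed
    then show ?thesis using ext_cone[OF coneC] ext_sub ext_mem[OF zC] by (auto simp: A_def)
  qed
  moreover have "\<Union>\<C> \<in> A" if "\<C> \<noteq> {}" "subset.chain A \<C>" for \<C>
  proof -
    have sub: "\<And>D. D \<in> \<C> \<Longrightarrow> D \<in> A" and ch: "\<And>D D'. D \<in> \<C> \<Longrightarrow> D' \<in> \<C> \<Longrightarrow> D \<subseteq> D' \<or> D' \<subseteq> D"
      using that(2) by (auto simp: subset_chain_def)
    have "cone (\<Union>\<C>)"
      unfolding cone_def
    proof (intro conjI ballI allI impI)
      fix y z assume "y \<in> \<Union>\<C>" "z \<in> \<Union>\<C>"
      then obtain D D' where "D \<in> \<C>" "D' \<in> \<C>" "y \<in> D" "z \<in> D'" by auto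
      with ch[of D D'] obtain D'' where "D'' \<in> \<C>" "y \<in> D''" "z \<in> D''" by auto
      then show "y + z \<in> \<Union>\<C>" using sub[of D''] by (auto simp: A_def cone_def)
    next
      fix r :: real and y assume "r \<ge> 0" "y \<in> \<Union>\<C>"
      then show "r \<cdot> y \<in> \<Union>\<C>" using sub by (fastforce simp: A_def cone_def)
    qed
    then show ?thesis using that(1) sub by (fastforce simp: A_def)
  qed
  ultimately obtain D where D: "D \<in> A" and max: "\<And>D'. D' \<in> A \<Longrightarrow> D \<subseteq> D' \<Longrightarrow> D' = D"
    using subset_Zorn_nonempty[of A] by blast
  have D_add: "\<And>y z. y \<in> D \<Longrightarrow> z \<in> D \<Longrightarrow> y + z \<in> D"
    and D_scale: "\<And>r y. r \<ge> 0 \<Longrightarrow> y \<in> D \<Longrightarrow> r \<cdot> y \<in> D"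
    and CD: "C \<subseteq> D" and mx: "- x \<in> D" and me: "- e \<notin> D" and coneD: "cone D"
    using D by (auto simp: A_def cone_def)
  have zD: "0 \<in> D" using zC CD by auto
  \<comment> \<open>By maximality, adjoining \<open>y\<close> to \<open>D\<close> must bring in
    \<open>- e\<close>. The coefficient \<open>t\<close> is not 0, since \<open>- e\<close> is not
    in \<open>D\<close>.\<close>
  have ne: "\<exists>d\<in>D. \<exists>t>0. - e = d + t \<cdot> y" if "y \<notin> D" for y
  proof -
    have "ext D y \<notin> A" using max[OF _ ext_sub, of y] ext_mem[OF zD, of y] that by auto
    then have "- e \<in> ext D y" using ext_cone[OF coneD, of y] ext_sub[of D y] CD mx by (auto simp: A_def)
    then obtain d t where dt: "d \<in> D" "t \<ge> 0" "- e = d + t \<cdot> y" unfolding ext_def by auto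
    then have "t \<noteq> 0" using me by auto
    then have "t > 0" using dt(2) by simp
    then show ?thesis using dt by blast
  qed
  have total: "y \<in> D \<or> - y \<in> D" for y
  proof (rule ccontr)
    assume "\<not> ?thesis"
    then obtain d t d' t' where *: "d \<in> D" "t > 0" "- e = d + t \<cdot> y" "d' \<in> D" "t' > 0" "- e = d' + t' \<cdot> (- y)"
      using ne[of y] ne[of "- y"] by blast
    \<comment> \<open>The weights \<open>t'\<close> and \<open>t\<close> cancel the \<open>y\<close>
      terms of the two representations and leave a positive multiple of \<open>- e\<close> in
      \<open>D\<close>.\<close>
    have "t' \<cdot> (- e) + t \<cdot> (- e) = t' \<cdot> (d + t \<cdot> y) + t \<cdot> (d' + t' \<cdot> (- y))"
      by (subst (1) *(3), subst *(6)) simp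
    also have "\<dots> = t' \<cdot> d + t \<cdot> d'"
      by (simp add: scale_right_distrib scale_right_diff_distrib mult.commute)
    finally have "(t' + t) \<cdot> (- e) = t' \<cdot> d + t \<cdot> d'" by (simp only: scale_left_distrib)
    moreover have "t' \<cdot> d + t \<cdot> d' \<in> D" using * by (intro D_add D_scale) auto
    ultimately have "(t' + t) \<cdot> (- e) \<in> D" by simp
    then have "(1/(t'+t)) \<cdot> ((t' + t) \<cdot> (- e)) \<in> D" by (rule D_scale[rotated]) (use *(2,5) in simp)
    then show False using me *(2,5) by simp
  qed
  have eD: "r \<cdot> e \<in> D \<longleftrightarrow> r \<ge> 0" for r
  proof
    assume r: "r \<cdot> e \<in> D"
    show "r \<ge> 0"
    proof (rule ccontr)
      assume "\<not> r \<ge> 0"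
      then have "(1/(-r)) \<cdot> (r \<cdot> e) \<in> D" using D_scale[OF _ r, of "1/(-r)"] by simp
      then show False using me \<open>\<not> r \<ge> 0\<close> by simp
    qed
  qed (use eC CD D_scale in auto)
  define Al where "Al = (\<lambda>y. {r. y - r \<cdot> e \<in> D})"
  define f where "f = (\<lambda>y. Sup (Al y))"
  have B: "Al y \<noteq> {} \<and> bdd_above (Al y)" if y: "y \<in> B" for y
  proof -
    obtain M where M: "M \<cdot> e - y \<in> D" "M \<cdot> e + y \<in> D" using y CD by (auto simp: B_def)
    have "- M \<in> Al y" using M by (simp add: Al_def add.commute)
    moreover have "r \<le> M" if "r \<in> Al y" for r
    proof -
      have "(M \<cdot> e - y) + (y - r \<cdot> e) \<in> D" by (rule D_add[OF M(1)]) (use that in \<open>simp add: Al_def\<close>)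
      then have "(M - r) \<cdot> e \<in> D" by (simp add: scale_left_diff_distrib)
      then show ?thesis using eD by simp
    qed
    ultimately show ?thesis by (auto simp: bdd_above_def)
  qed
  have lower: "r \<in> Al y" if y: "y \<in> B" and r: "r < f y" for r y
  proof -
    obtain s where s: "s \<in> Al y" "r < s" using less_cSupD[of "Al y" r] B[OF y] r by (auto simp: f_def)
    have "(y - s \<cdot> e) + (s - r) \<cdot> e \<in> D" by (rule D_add) (use s eD in \<open>auto simp: Al_def\<close>)
    then show ?thesis by (simp add: Al_def scale_left_diff_distrib)
  qed
  have upper: "r \<cdot> e - y \<in> D" if "y \<in> B" "f y < r" for r y
  proof -
    have "r \<notin> Al y" using cSup_upper[of r "Al y"] B[OF that(1)] that(2) by (auto simp: f_def)
    then show ?thesis using total[of "y - r \<cdot> e"] by (simp add: Al_def)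
  qed
  \<comment> \<open>Both conditions are strict because totality does not say which of
    \<open>y - f y \<cdot> e\<close> and its negative lies in \<open>D\<close>. Computing
    \<open>f\<close> through this criterion never has to decide the boundary case.\<close>
  have fI: "f y = c" if "y \<in> B" and l: "\<And>r. r < c \<Longrightarrow> r \<in> Al y" and u: "\<And>r. c < r \<Longrightarrow> r \<cdot> e - y \<in> D" for y c
  proof (rule antisym)
    show "f y \<le> c"
    proof (rule ccontr)
      assume "\<not> f y \<le> c"
      then obtain r s where rs: "c < s" "s < r" "r < f y" by (meson dense not_le)
      have "(y - r \<cdot> e) + (s \<cdot> e - y) \<in> D" 
        by (rule D_add) (use lower[OF that(1) rs(3)] u[OF rs(1)] in \<open>auto simp: Al_def\<close>)
      then have "(s - r) \<cdot> e \<in> D" by (simp add: scale_left_diff_distrib)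
      then show False using eD rs by simp
    qed
    show "c \<le> f y"
    proof (rule ccontr)
      assume "\<not> c \<le> f y"
      then obtain r where r: "f y < r" "r < c" by (meson dense not_le)
      then show False using cSup_upper[OF l[OF r(2)]] B[OF that(1)] by (simp add: f_def)
    qed
  qed
  have addB: "y + z \<in> B" if "y \<in> B" "z \<in> B" for y z
    using order_unit_subspace[OF vs C_add C_scale eC, folded B_def] that by (simp add: subspace_add)
  have scaleB: "r \<cdot> y \<in> B" if "y \<in> B" for y r
    using order_unit_subspace[OF vs C_add C_scale eC, folded B_def] that by (simp add: subspace_scale)
  have f_add: "f (y + z) = f y + f z" if yz: "y \<in> B" "z \<in> B" for y z
  proof (rule fI[OF addB[OF yz]])
    fix r assume "r < f y + f z"
    define d where "d = (f y + f z - r) / 2"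
    have d: "d > 0" "r = (f y - d) + (f z - d)" using \<open>r < f y + f z\<close> by (simp_all add: d_def field_simps)
    have "(y - (f y - d) \<cdot> e) + (z - (f z - d) \<cdot> e) \<in> D"
      by (rule D_add) (use lower[OF yz(1), of "f y - d"] lower[OF yz(2), of "f z - d"] d in \<open>auto simp: Al_def\<close>)
    also have "(y - (f y - d) \<cdot> e) + (z - (f z - d) \<cdot> e) = y + z - r \<cdot> e"
      by (subst d(2), subst scale_left_distrib) (simp add: algebra_simps)
    finally show "r \<in> Al (y + z)" by (simp add: Al_def)
  next
    fix r assume "f y + f z < r"
    define d where "d = (r - f y - f z) / 2"
    have d: "d > 0" "r = (f y + d) + (f z + d)" using \<open>f y + f z < r\<close> by (simp_all add: d_def field_simps)
    have "((f y + d) \<cdot> e - y) + ((f z + d) \<cdot> e - z) \<in> D"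
      by (rule D_add) (use upper[OF yz(1), of "f y + d"] upper[OF yz(2), of "f z + d"] d in auto)
    also have "((f y + d) \<cdot> e - y) + ((f z + d) \<cdot> e - z) = r \<cdot> e - (y + z)"
      by (subst d(2), subst scale_left_distrib) (simp add: algebra_simps)
    finally show "r \<cdot> e - (y + z) \<in> D" .
  qed
  have zB: "0 \<in> B" using scaleB[OF xB, of 0] by simp
  have f0: "f 0 = 0" using f_add[OF zB zB] by simp
  have f_pos: "f (r \<cdot> y) = r * f y" if y: "y \<in> B" and r: "r > 0" for r y
  proof (rule fI[OF scaleB[OF y]])
    fix s assume "s < r * f y"
    then have "s / r \<in> Al y" using lower[OF y] r by (simp add: field_simps)
    then show "s \<in> Al (r \<cdot> y)" using D_scale[of r "y - (s/r) \<cdot> e"] r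
      by (auto simp: Al_def scale_right_diff_distrib)
  next
    fix s assume "r * f y < s"
    then have "(s/r) \<cdot> e - y \<in> D" using upper[OF y] r by (simp add: field_simps)
    then show "s \<cdot> e - r \<cdot> y \<in> D" using D_scale[of r "(s/r) \<cdot> e - y"] r
      by (auto simp: scale_right_diff_distrib)
  qed
  have f_scale: "f (r \<cdot> y) = r * f y" if y: "y \<in> B" for r y
  proof (cases "r > 0")
    case False
    have "r \<cdot> y + (-r) \<cdot> y = 0" by simp
    then have "0 = f (r \<cdot> y) + f ((-r) \<cdot> y)"
      using f_add[OF scaleB[OF y] scaleB[OF y], of r "- r"] f0 by simp
    moreover have "f ((-r) \<cdot> y) = (-r) * f y"
      using f_pos[OF y, of "-r"] False f0 by (cases "r = 0") auto
    ultimately show ?thesis by linarith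
  qed (rule f_pos[OF y])
  have eB: "e \<in> B"
    unfolding B_def using zC C_add[OF eC eC] by (intro CollectI exI[of _ 1]) simp
  show thesis
  proof (rule that[of f])
    show "0 \<le> f y" if "y \<in> B" "y \<in> C" for y
      using cSup_upper[of 0 "Al y"] B[OF that(1)] that(2) CD by (auto simp: f_def Al_def)
    show "f e = 1"
    proof (rule fI[OF eB])
      fix r :: real assume "r < 1"
      then have "(1 - r) \<cdot> e \<in> D" using eD[of "1 - r"] by (simp only: diff_ge_0_iff_ge less_imp_le)
      then show "r \<in> Al e" by (simp add: Al_def scale_left_diff_distrib)
    next
      fix r :: real assume "1 < r"
      then have "(r - 1) \<cdot> e \<in> D" using eD[of "r - 1"] by (simp only: diff_ge_0_iff_ge less_imp_le)
      then show "r \<cdot> e - e \<in> D" by (simp add: scale_left_diff_distrib)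
    qed
    show "f x \<le> 0"
      unfolding f_def
    proof (rule cSup_least)
      show "Al x \<noteq> {}" using B[OF xB] by simp
      fix r assume "r \<in> Al x"
      then have "x - r \<cdot> e \<in> D" by (simp only: Al_def mem_Collect_eq)
      then have "(x - r \<cdot> e) + - x \<in> D" by (rule D_add[OF _ mx])
      then have "(- r) \<cdot> e \<in> D" by simp
      then have "0 \<le> - r" by (rule eD[THEN iffD1])
      then show "r \<le> 0" by simp
    qed
  qed (rule f_add f_scale; assumption)+
qed


subsection \<open>The Hilbert space of square-summable sequences\<close>

definition ell2 :: "(nat \<Rightarrow> complex) set" where
  "ell2 = {h. summable (\<lambda>k. (cmod (h k))\<^sup>2)}"

definition ell2_norm :: "(nat \<Rightarrow> complex) \<Rightarrow> real" where
  "ell2_norm h = sqrt (suminf (\<lambda>k. (cmod (h k))\<^sup>2))"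

text \<open>The locale \<open>Metric_space\<close> asks for a symmetric and nonnegative distance function outside of the
  carrier, too, and \<open>mcomplete\<close> has no unconditional unfolding rule. For this reason addition
  replaces sequences outside of \<open>ell2\<close> by \<open>0\<close>.\<close>

definition ell2_proj :: "(nat \<Rightarrow> complex) \<Rightarrow> nat \<Rightarrow> complex" where
  "ell2_proj h = (if h \<in> ell2 then h else (\<lambda>_. 0))"

definition ell2_space :: "(nat \<Rightarrow> complex) inner_space" where
  "ell2_space = \<lparr>carrier = ell2, monoid.mult = (\<lambda>_ _ _. 0), one = (\<lambda>_. 0), zero = (\<lambda>_. 0),
     add = (\<lambda>h g k. ell2_proj h k + ell2_proj g k), smult = (\<lambda>c h k. c * h k),
     cinner = (\<lambda>h g. suminf (\<lambda>k. h k * cnj (g k)))\<rparr>"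

lemma ell2_space_simps [simp]:
  "carrier ell2_space = ell2" "\<zero>\<^bsub>ell2_space\<^esub> = (\<lambda>_. 0)"
  "c \<odot>\<^bsub>ell2_space\<^esub> h = (\<lambda>k. c * h k)"
  "cinner ell2_space h g = suminf (\<lambda>k. h k * cnj (g k))"
  by (simp_all add: ell2_space_def)

lemma add_ell2_space_proj: "h \<oplus>\<^bsub>ell2_space\<^esub> g = (\<lambda>k. ell2_proj h k + ell2_proj g k)"
  by (simp add: ell2_space_def)

lemma add_ell2_space [simp]:
  "h \<in> ell2 \<Longrightarrow> g \<in> ell2 \<Longrightarrow> h \<oplus>\<^bsub>ell2_space\<^esub> g = (\<lambda>k. h k + g k)"
  by (simp add: add_ell2_space_proj ell2_proj_def)

text \<open>Bounds on finite partial sums give membership and the norm estimate together. Sums,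
  limits and transposed operators are all controlled in this way.\<close>

lemma ell2I:
  assumes "\<And>n. (\<Sum>k<n. (cmod (h k))\<^sup>2) \<le> M\<^sup>2" "0 \<le> M"
  shows "h \<in> ell2" "ell2_norm h \<le> M"
proof -
  have s: "summable (\<lambda>k. (cmod (h k))\<^sup>2)"
    by (rule summableI_nonneg_bounded[OF _ assms(1)]) simp
  then show "h \<in> ell2" by (simp add: ell2_def)
  have "(suminf (\<lambda>k. (cmod (h k))\<^sup>2)) \<le> M\<^sup>2"
    by (rule suminf_le_const[OF s assms(1)])
  then show "ell2_norm h \<le> M"
    unfolding ell2_norm_def by (rule real_le_lsqrt[OF assms(2)])
qed

lemma ell2_norm_nonneg: "h \<in> ell2 \<Longrightarrow> 0 \<le> ell2_norm h"
  unfolding ell2_norm_def ell2_def by (intro real_sqrt_ge_zero suminf_nonneg) auto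

lemma sum_le_ell2_norm:
  assumes "h \<in> ell2"
  shows "(\<Sum>k<n. (cmod (h k))\<^sup>2) \<le> (ell2_norm h)\<^sup>2"
proof -
  have s: "summable (\<lambda>k. (cmod (h k))\<^sup>2)" using assms by (simp add: ell2_def)
  have "(ell2_norm h)\<^sup>2 = suminf (\<lambda>k. (cmod (h k))\<^sup>2)"
    unfolding ell2_norm_def by (intro real_sqrt_pow2 suminf_nonneg s) simp
  then show ?thesis using sum_le_suminf[OF s, of "{..<n}"] by simp
qed

lemma cmod_le_ell2_norm:
  assumes "h \<in> ell2"
  shows "cmod (h k) \<le> ell2_norm h"
proof -
  have "(cmod (h k))\<^sup>2 \<le> (\<Sum>k<Suc k. (cmod (h k))\<^sup>2)"
    by (simp add: sum_nonneg)
  also have "\<dots> \<le> (ell2_norm h)\<^sup>2" by (rule sum_le_ell2_norm[OF assms])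
  finally show ?thesis by (rule power2_le_imp_le[OF _ ell2_norm_nonneg[OF assms]])
qed

lemma ell2_add:
  assumes "h \<in> ell2" "g \<in> ell2"
  shows "(\<lambda>k. h k + g k) \<in> ell2" "ell2_norm (\<lambda>k. h k + g k) \<le> ell2_norm h + ell2_norm g"
proof -
  have "(\<Sum>k<n. (cmod (h k + g k))\<^sup>2) \<le> (ell2_norm h + ell2_norm g)\<^sup>2" for n
  proof -
    have "sqrt (\<Sum>k<n. (cmod (h k + g k))\<^sup>2) \<le> L2_set (\<lambda>k. cmod (h k) + cmod (g k)) {..<n}"
      unfolding L2_set_def by (intro real_sqrt_le_mono sum_mono power_mono) (auto intro: norm_triangle_ineq)
    also have "\<dots> \<le> L2_set (\<lambda>k. cmod (h k)) {..<n} + L2_set (\<lambda>k. cmod (g k)) {..<n}"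
      by (rule L2_set_triangle_ineq)
    also have "\<dots> \<le> ell2_norm h + ell2_norm g"
      unfolding L2_set_def using assms by (intro add_mono real_le_lsqrt sum_le_ell2_norm ell2_norm_nonneg)
    finally show ?thesis by (rule sqrt_le_D)
  qed
  note ell2I[OF this add_nonneg_nonneg[OF ell2_norm_nonneg[OF assms(1)] ell2_norm_nonneg[OF assms(2)]]]
  then show "(\<lambda>k. h k + g k) \<in> ell2" "ell2_norm (\<lambda>k. h k + g k) \<le> ell2_norm h + ell2_norm g" .
qed

lemma ell2_scale:
  assumes "h \<in> ell2"
  shows "(\<lambda>k. c * h k) \<in> ell2" "ell2_norm (\<lambda>k. c * h k) = cmod c * ell2_norm h"
proof -
  have s: "summable (\<lambda>k. (cmod (h k))\<^sup>2)" using assms by (simp add: ell2_def)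
  show "(\<lambda>k. c * h k) \<in> ell2"
    using s summable_mult[OF s, of "(cmod c)\<^sup>2"] by (simp add: ell2_def norm_mult power_mult_distrib)
  show "ell2_norm (\<lambda>k. c * h k) = cmod c * ell2_norm h"
    using suminf_mult[OF s] by (simp add: ell2_norm_def norm_mult power_mult_distrib real_sqrt_mult)
qed

lemma ell2_diff:
  assumes "h \<in> ell2" "g \<in> ell2"
  shows "(\<lambda>k. h k - g k) \<in> ell2"
  using ell2_add(1)[OF assms(1) ell2_scale(1)[OF assms(2), of "-1"]] by simp

lemma zero_in_ell2: "(\<lambda>_. 0) \<in> ell2"
  by (simp add: ell2_def)

lemma ell2_sum:
  assumes "\<And>a. a \<in> A \<Longrightarrow> f a \<in> ell2"
  shows "(\<lambda>k. \<Sum>a\<in>A. f a k) \<in> ell2"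
  using assms by (induction A rule: infinite_finite_induct) (auto simp: zero_in_ell2 intro!: ell2_add)

lemma ell2_finite_support:
  assumes "\<And>k. k \<ge> n \<Longrightarrow> h k = 0"
  shows "h \<in> ell2" "(ell2_norm h)\<^sup>2 = (\<Sum>k<n. (cmod (h k))\<^sup>2)"
proof -
  show "h \<in> ell2"
    unfolding ell2_def by (intro CollectI summable_finite[of "{..<n}"]) (auto simp: assms)
  have "(suminf (\<lambda>k. (cmod (h k))\<^sup>2)) = (\<Sum>k<n. (cmod (h k))\<^sup>2)"
    by (intro suminf_finite) (auto simp: assms)
  then show "(ell2_norm h)\<^sup>2 = (\<Sum>k<n. (cmod (h k))\<^sup>2)" by (simp add: ell2_norm_def sum_nonneg)
qed

lemma ell2_summable_inner:
  assumes "h \<in> ell2" "g \<in> ell2"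
  shows "summable (\<lambda>k. h k * cnj (g k))"
proof (rule summable_comparison_test')
  show "summable (\<lambda>k. (cmod (h k))\<^sup>2 + (cmod (g k))\<^sup>2)"
    using assms by (intro summable_add) (auto simp: ell2_def)
  show "norm (h k * cnj (g k)) \<le> (cmod (h k))\<^sup>2 + (cmod (g k))\<^sup>2" if "k \<ge> 0" for k
  proof -
    have "2 * cmod (h k) * cmod (g k) \<le> (cmod (h k))\<^sup>2 + (cmod (g k))\<^sup>2"
      by (rule sum_squares_bound)
    moreover have "0 \<le> cmod (h k) * cmod (g k)" by simp
    ultimately have "cmod (h k) * cmod (g k) \<le> (cmod (h k))\<^sup>2 + (cmod (g k))\<^sup>2" by linarith
    then show ?thesis by (simp add: norm_mult)
  qed
qed

lemma hnorm_ell2_space: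
  assumes "h \<in> ell2"
  shows "hnorm ell2_space h = ell2_norm h"
proof -
  have "Re (suminf (\<lambda>k. h k * cnj (h k))) = (suminf (\<lambda>k. Re (h k * cnj (h k))))"
    by (rule bounded_linear.suminf[OF bounded_linear_Re ell2_summable_inner[OF assms assms], symmetric, THEN sym])
  also have "\<dots> = (suminf (\<lambda>k. (cmod (h k))\<^sup>2))" by (simp add: complex_norm_square[symmetric])
  finally show ?thesis by (simp add: hnorm_def ell2_norm_def)
qed

section \<open>The Hilbert space structure on square-summable sequences\<close>

lemma abelian_group_ell2_space: "abelian_group ell2_space"
proof (rule abelian_groupI)
  fix h assume "h \<in> carrier ell2_space"
  then have "(\<lambda>k. - h k) \<in> ell2" using ell2_scale(1)[of h "-1"] by simp
  then show "\<exists>g\<in>carrier ell2_space. g \<oplus>\<^bsub>ell2_space\<^esub> h = \<zero>\<^bsub>ell2_space\<^esub>"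
    using \<open>h \<in> carrier ell2_space\<close> by (intro bexI[of _ "\<lambda>k. - h k"]) auto
qed (auto simp: ell2_add zero_in_ell2 algebra_simps)

lemma ell2_proj_in: "ell2_proj h \<in> ell2"
  by (simp add: ell2_proj_def zero_in_ell2)

text \<open>There are no hypotheses on \<open>h\<close> and \<open>g\<close>. Since addition
  projects its arguments, a sequence outside of \<open>ell2\<close> still has exactly one additive
  inverse in the carrier, namely 0, so the definite description in the library's inverse is
  determined everywhere. This makes \<open>hdist\<close> symmetric and nonnegative on the whole
  type.\<close>

lemma ell2_space_minus: "h \<ominus>\<^bsub>ell2_space\<^esub> g = (\<lambda>k. ell2_proj h k - ell2_proj g k)"
proof -
  have neg: "(\<lambda>k. - ell2_proj g k) \<in> ell2"
    using ell2_scale(1)[OF ell2_proj_in, of "-1" g] by simp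
  have "\<ominus>\<^bsub>ell2_space\<^esub> g = (\<lambda>k. - ell2_proj g k)"
    unfolding a_inv_def m_inv_def
  proof (rule the_equality, goal_cases)
    case 1
    then show ?case using neg by (simp add: add_ell2_space_proj ell2_proj_def)
  next
    case (2 f)
    then have "ell2_proj f k = f k" "ell2_proj f k + ell2_proj g k = 0" for k
      by (auto simp: add_ell2_space_proj ell2_proj_def dest: fun_cong)
    then show ?case by (auto simp: fun_eq_iff eq_neg_iff_add_eq_0)
  qed
  then show ?thesis using neg ell2_proj_in
    by (simp add: a_minus_def add_ell2_space_proj) (simp add: ell2_proj_def)
qed

lemma finsum_ell2_space:
  assumes "finite A" "\<And>a. a \<in> A \<Longrightarrow> f a \<in> ell2"
  shows "finsum ell2_space f A = (\<lambda>k. \<Sum>a\<in>A. f a k)"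
proof -
  interpret abelian_group ell2_space by (rule abelian_group_ell2_space)
  show ?thesis using assms
    by (induction A) (auto simp: finsum_insert ell2_sum)
qed

lemma cring_complex_ring: "cring complex_ring"
proof (rule cringI)
  show "abelian_group complex_ring"
    by (rule abelian_groupI) (auto simp: complex_ring_def intro: exI[of _ "- x" for x])
  show "comm_monoid complex_ring"
    by (rule comm_monoidI) (auto simp: complex_ring_def)
qed (auto simp: complex_ring_def algebra_simps)

lemma hdist_ell2_space:
  "hdist ell2_space h g = ell2_norm (\<lambda>k. ell2_proj h k - ell2_proj g k)"
  by (simp add: hdist_def ell2_space_minus hnorm_ell2_space ell2_diff ell2_proj_in)

text \<open>The candidate \<open>x\<close> is the coordinatewise limit. The Cauchy estimate holds
  for every finite partial sum and passes to the limit there. It also gives membership of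
  \<open>x\<close>, as the difference of \<open>s N\<close> and \<open>s N - x\<close>.\<close>

lemma ell2_complete:
  fixes s :: "nat \<Rightarrow> nat \<Rightarrow> complex"
  assumes s: "\<And>n. s n \<in> ell2"
    and cauchy: "\<And>e. e > 0 \<Longrightarrow> \<exists>N. \<forall>m\<ge>N. \<forall>n\<ge>N. ell2_norm (\<lambda>k. s m k - s n k) < e"
  obtains x where "x \<in> ell2" "\<And>e. e > 0 \<Longrightarrow> \<exists>N. \<forall>n\<ge>N. ell2_norm (\<lambda>k. s n k - x k) < e"
proof -
  have "Cauchy (\<lambda>n. s n k)" for k
  proof (rule CauchyI)
    fix e :: real assume "e > 0"
    then obtain N where N: "\<And>m n. m \<ge> N \<Longrightarrow> n \<ge> N \<Longrightarrow> ell2_norm (\<lambda>k. s m k - s n k) < e"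
      using cauchy by blast
    have "cmod (s m k - s n k) < e" if "m \<ge> N" "n \<ge> N" for m n
      using cmod_le_ell2_norm[OF ell2_diff[OF s s], of m k n] N[OF that] by linarith
    then show "\<exists>N. \<forall>m\<ge>N. \<forall>n\<ge>N. cmod (s m k - s n k) < e" by blast
  qed
  then have "\<exists>l. (\<lambda>n. s n k) \<longlonglongrightarrow> l" for k
    using Cauchy_convergent convergent_def by blast
  then obtain x where x: "\<And>k. (\<lambda>n. s n k) \<longlonglongrightarrow> x k" by metis
  have bound: "(\<lambda>k. s m k - x k) \<in> ell2 \<and> ell2_norm (\<lambda>k. s m k - x k) \<le> e"
    if e: "e > 0" and N: "\<And>n. n \<ge> N \<Longrightarrow> ell2_norm (\<lambda>k. s m k - s n k) < e" for e m N
  proof -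
    have "(\<Sum>k<K. (cmod (s m k - x k))\<^sup>2) \<le> e\<^sup>2" for K
    proof (rule LIMSEQ_le_const2)
      show "(\<lambda>n. \<Sum>k<K. (cmod (s m k - s n k))\<^sup>2) \<longlonglongrightarrow> (\<Sum>k<K. (cmod (s m k - x k))\<^sup>2)"
        by (intro tendsto_intros x)
      have "(\<Sum>k<K. (cmod (s m k - s n k))\<^sup>2) \<le> e\<^sup>2" if "n \<ge> N" for n
      proof -
        have "(\<Sum>k<K. (cmod (s m k - s n k))\<^sup>2) \<le> (ell2_norm (\<lambda>k. s m k - s n k))\<^sup>2"
          by (rule sum_le_ell2_norm[OF ell2_diff[OF s s]])
        also have "\<dots> \<le> e\<^sup>2"
          using N[OF that] ell2_norm_nonneg[OF ell2_diff[OF s s], of m n] by (intro power_mono) auto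
        finally show ?thesis .
      qed
      then show "\<exists>N. \<forall>n\<ge>N. (\<Sum>k<K. (cmod (s m k - s n k))\<^sup>2) \<le> e\<^sup>2" by blast
    qed
    from ell2I[OF this] e show ?thesis by simp
  qed
  show thesis
  proof (rule that[of x])
    obtain N where N: "\<And>m n. m \<ge> N \<Longrightarrow> n \<ge> N \<Longrightarrow> ell2_norm (\<lambda>k. s m k - s n k) < 1"
      using cauchy[of 1] by auto
    have "(\<lambda>k. s N k - x k) \<in> ell2" using bound[of 1 N N] N by auto
    from ell2_diff[OF s[of N] this] show "x \<in> ell2" by simp
    fix e :: real assume "e > 0"
    \<comment> \<open>\<open>bound\<close> comes from a limit and yields a non-strict inequality,
      hence \<open>e/2\<close>.\<close>
    then obtain N where N: "\<And>m n. m \<ge> N \<Longrightarrow> n \<ge> N \<Longrightarrow> ell2_norm (\<lambda>k. s m k - s n k) < e/2"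
      using cauchy[of "e/2"] by (meson half_gt_zero)
    have "ell2_norm (\<lambda>k. s m k - x k) < e" if "m \<ge> N" for m
      using bound[of "e/2" N m] N[OF that] \<open>e > 0\<close> by force
    then show "\<exists>N. \<forall>n\<ge>N. ell2_norm (\<lambda>k. s n k - x k) < e" by blast
  qed
qed

lemma mcomplete_ell2_space: "Metric_space.mcomplete (carrier ell2_space) (hdist ell2_space)"
proof -
  interpret Metric_space ell2 "hdist ell2_space"
  proof
    fix h g
    show "hdist ell2_space h g = hdist ell2_space g h"
      by (simp add: hdist_ell2_space ell2_norm_def norm_minus_commute)
    show "0 \<le> hdist ell2_space h g"
      by (simp add: hdist_ell2_space ell2_norm_nonneg ell2_diff ell2_proj_in)
  next
    fix h g assume hg: "h \<in> ell2" "g \<in> ell2"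
    show "hdist ell2_space h g = 0 \<longleftrightarrow> h = g"
    proof
      assume "hdist ell2_space h g = 0"
      then have "cmod (h k - g k) \<le> 0" for k
        using cmod_le_ell2_norm[OF ell2_diff[OF hg], of k] hg by (simp add: hdist_ell2_space ell2_proj_def)
      then show "h = g" by (auto simp: fun_eq_iff)
    qed (simp add: hdist_ell2_space ell2_norm_def)
  next
    fix h g l assume hgl: "h \<in> ell2" "g \<in> ell2" "l \<in> ell2"
    show "hdist ell2_space h l \<le> hdist ell2_space h g + hdist ell2_space g l"
      using ell2_add(2)[OF ell2_diff[OF hgl(1,2)] ell2_diff[OF hgl(2,3)]] hgl
      by (simp add: hdist_ell2_space ell2_proj_def)
  qed
  have d: "hdist ell2_space h g = ell2_norm (\<lambda>k. h k - g k)" if "h \<in> ell2" "g \<in> ell2" for h g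
    using that by (simp add: hdist_ell2_space ell2_proj_def)
  have "\<exists>x. limitin mtopology s x sequentially" if "MCauchy s" for s
  proof -
    have s: "s n \<in> ell2" for n using that by (auto simp: MCauchy_def)
    moreover have "\<exists>N. \<forall>m\<ge>N. \<forall>n\<ge>N. ell2_norm (\<lambda>k. s m k - s n k) < e" if "e > 0" for e
    proof -
      from \<open>MCauchy s\<close> that obtain N where "\<And>m n. N \<le> m \<Longrightarrow> N \<le> n \<Longrightarrow> hdist ell2_space (s m) (s n) < e"
        unfolding MCauchy_def by blast
      then show ?thesis unfolding d[OF s s] by blast
    qed
    ultimately obtain x where "x \<in> ell2" "\<And>e. e > 0 \<Longrightarrow> \<exists>N. \<forall>n\<ge>N. ell2_norm (\<lambda>k. s n k - x k) < e"
      using ell2_complete[of s] by metis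
    then have "limitin mtopology s x sequentially"
      unfolding limit_metric_sequentially using d s by simp
    then show ?thesis by blast
  qed
  then show ?thesis by (simp add: mcomplete_def)
qed

lemma complex_hilbert_space_ell2_space: "complex_hilbert_space ell2_space"
proof -
  have "Module.module complex_ring ell2_space"
    by (rule moduleI)
      (use cring_complex_ring in \<open>auto simp: abelian_group_ell2_space ell2_scale complex_ring_def algebra_simps\<close>)
  moreover have "complex_hilbert_space_axioms ell2_space"
  proof (unfold_locales, goal_cases)
    case (1 x y z)
    then show ?case
      using suminf_add[OF ell2_summable_inner ell2_summable_inner, of x z y z] by (simp add: algebra_simps)
  next
    case (2 x y c)
    then show ?case
      using suminf_mult[OF ell2_summable_inner, of x y c] by (simp add: mult.assoc)
  next
    case (3 x y)
    then show ?case
      using bounded_linear.suminf[OF bounded_linear_cnj ell2_summable_inner, of x y]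
      by (simp add: mult.commute)
  next
    case (4 x)
    then have x: "x \<in> ell2" "summable (\<lambda>k. (cmod (x k))\<^sup>2)" by (auto simp: ell2_def)
    from 4 obtain k where "x k \<noteq> 0" by auto
    then have "0 < cmod (x k)" by simp
    also have "\<dots> \<le> hnorm ell2_space x" using cmod_le_ell2_norm[OF x(1)] hnorm_ell2_space[OF x(1)] by simp
    finally show ?case by (simp add: hnorm_def)
  next
    case 5 show ?case by (rule mcomplete_ell2_space)
  qed
  ultimately show ?thesis by (simp add: complex_hilbert_space_def)
qed


subsection \<open>Gram--Schmidt for a semi-inner product\<close>

text \<open>The form is constrained only on a subspace \<open>V\<close> because it arises from a
  functional that is controlled only on the span of certain kernels. It is only semidefinite, as the
  separating functional may vanish on squares of nonzero vectors.\<close>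

locale semi_inner_product = vector_space scale
  for scale :: "complex \<Rightarrow> 'v::ab_group_add \<Rightarrow> 'v" (infixr \<open>\<cdot>\<close> 75) +
  fixes V :: "'v set" and F :: "'v \<Rightarrow> 'v \<Rightarrow> complex"
  assumes V_subspace: "subspace V"
    and F_add: "x \<in> V \<Longrightarrow> y \<in> V \<Longrightarrow> z \<in> V \<Longrightarrow> F (x + y) z = F x z + F y z"
    and F_scale: "x \<in> V \<Longrightarrow> y \<in> V \<Longrightarrow> F (c \<cdot> x) y = c * F x y"
    and F_commute: "x \<in> V \<Longrightarrow> y \<in> V \<Longrightarrow> F y x = cnj (F x y)"
    and F_nonneg: "x \<in> V \<Longrightarrow> 0 \<le> Re (F x x)"
begin

lemmas V_intros = subspace_0[OF V_subspace] subspace_add[OF V_subspace] subspace_scale[OF V_subspace]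
  subspace_diff[OF V_subspace] subspace_sum[OF V_subspace]

lemma F_add_right: "x \<in> V \<Longrightarrow> y \<in> V \<Longrightarrow> z \<in> V \<Longrightarrow> F x (y + z) = F x y + F x z"
  by (metis F_add F_commute V_intros(2) complex_cnj_add)

lemma F_scale_right: "x \<in> V \<Longrightarrow> y \<in> V \<Longrightarrow> F x (c \<cdot> y) = cnj c * F x y"
  by (metis F_scale F_commute V_intros(3) complex_cnj_mult)

lemma F_zero: "x \<in> V \<Longrightarrow> F 0 x = 0"
  using F_scale[of x x 0] by simp

lemma F_diff: "x \<in> V \<Longrightarrow> y \<in> V \<Longrightarrow> z \<in> V \<Longrightarrow> F (x - y) z = F x z - F y z"
  using F_add[of "x - y" y z] V_intros by simp

lemma F_diff_right: "x \<in> V \<Longrightarrow> y \<in> V \<Longrightarrow> z \<in> V \<Longrightarrow> F x (y - z) = F x y - F x z"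
  using F_add_right[of x "y - z" z] V_intros by simp

lemma F_sum:
  assumes "\<And>a. a \<in> A \<Longrightarrow> f a \<in> V" "x \<in> V"
  shows "F (\<Sum>a\<in>A. f a) x = (\<Sum>a\<in>A. F (f a) x)"
  using assms by (induction A rule: infinite_finite_induct) (auto simp: F_zero F_add V_intros)

lemma F_self: "x \<in> V \<Longrightarrow> F x x = of_real (Re (F x x))"
  using F_commute[of x x] by (simp add: complex_eq_iff)

lemma cauchy_schwarz:
  assumes x: "x \<in> V" and y: "y \<in> V"
  shows "(cmod (F x y))\<^sup>2 \<le> Re (F x x) * Re (F y y)"
proof -
  define a where "a = F x y"
  have expand: "Re (F (x - c \<cdot> y) (x - c \<cdot> y)) = Re (F x x) - 2 * Re (cnj c * a) + (cmod c)\<^sup>2 * Re (F y y)" for c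
  proof -
    have "F (x - c \<cdot> y) (x - c \<cdot> y) = F x x - cnj c * a - c * cnj a + c * cnj c * F y y"
      using x y F_commute[OF x y]
      by (simp add: F_diff F_diff_right F_scale F_scale_right V_intros a_def algebra_simps)
    moreover have "Re (c * cnj a) = Re (cnj c * a)" by simp
    moreover have "c * cnj c * F y y = of_real ((cmod c)\<^sup>2 * Re (F y y))"
      using F_self[OF y] complex_norm_square[of c] by simp
    ultimately show ?thesis by simp
  qed
  show ?thesis
  proof (cases "Re (F y y) = 0")
    case True
    have "a = 0"
    proof (rule ccontr)
      assume "a \<noteq> 0"
      \<comment> \<open>This \<open>t\<close> makes the term that is linear in \<open>t\<close>
        equal to \<open>Re (F x x) + 1\<close>. The quadratic term vanishes with
        \<open>F y y\<close>, so a square of length - 1 results.\<close>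
      define t where "t = (Re (F x x) + 1) / (2 * (cmod a)\<^sup>2)"
      have "Re (cnj (of_real t * a) * a) = t * (cmod a)\<^sup>2"
        by (simp add: cmod_power2) (simp add: power2_eq_square algebra_simps)
      then have "Re (F (x - (of_real t * a) \<cdot> y) (x - (of_real t * a) \<cdot> y)) = Re (F x x) - 2 * (t * (cmod a)\<^sup>2)"
        using expand[of "of_real t * a"] True by simp
      also have "\<dots> = - 1" using \<open>a \<noteq> 0\<close> by (simp add: t_def field_simps)
      finally show False using F_nonneg[of "x - (of_real t * a) \<cdot> y"] x y V_intros by simp
    qed
    then show ?thesis using True by (simp add: a_def)
  next
    case False
    then have pos: "Re (F y y) > 0" using F_nonneg[OF y] by simp
    define c where "c = a / of_real (Re (F y y))"
    have 1: "Re (cnj c * a) = (cmod a)\<^sup>2 / Re (F y y)"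
      unfolding c_def cmod_power2 by (simp add: add_divide_distrib power2_eq_square)
    have 2: "(cmod c)\<^sup>2 * Re (F y y) = (cmod a)\<^sup>2 / Re (F y y)"
      using pos by (simp add: c_def norm_divide power_divide power2_eq_square)
    have "0 \<le> Re (F (x - c \<cdot> y) (x - c \<cdot> y))" using F_nonneg x y V_intros by simp
    then have "(cmod a)\<^sup>2 / Re (F y y) \<le> Re (F x x)" unfolding expand 1 2 by simp
    then show ?thesis using pos by (simp add: a_def pos_divide_le_eq)
  qed
qed

definition null :: "'v set" where "null = {x \<in> V. F x x = 0}"

text \<open>By Cauchy--Schwarz, a vector of length 0 is orthogonal to all of \<open>V\<close>. Thus
  \<open>null\<close> is the radical of the form, and it is the error tolerated in the expansions
  below.\<close>

lemma null_iff: "x \<in> null \<longleftrightarrow> x \<in> V \<and> (\<forall>y\<in>V. F x y = 0)"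
proof
  assume "x \<in> null"
  then show "x \<in> V \<and> (\<forall>y\<in>V. F x y = 0)"
    using cauchy_schwarz[of x] by (auto simp: null_def)
qed (auto simp: null_def)

end

locale separable_semi_inner_product = semi_inner_product scale V F
  for scale :: "complex \<Rightarrow> 'v::ab_group_add \<Rightarrow> 'v" and V F +
  fixes b :: "nat \<Rightarrow> 'v"
  assumes b_span: "V = span (range b)"
begin

lemma b_in_V: "b n \<in> V"
  by (simp add: b_span span_base)

text \<open>Gram--Schmidt. Division by \<open>0\<close> turns null vectors into \<open>0\<close>, so that \<open>gs\<close> is an
  orthonormal sequence with zeros inserted.\<close>

fun gs :: "nat \<Rightarrow> 'v" where
  "gs n = (let w = b n - (\<Sum>k<n. scale (F (b n) (gs k)) (gs k))
           in scale (of_real (1 / sqrt (Re (F w w)))) w)"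

declare gs.simps [simp del]

definition gs_raw :: "nat \<Rightarrow> 'v" where
  "gs_raw n = b n - (\<Sum>k<n. scale (F (b n) (gs k)) (gs k))"

lemma gs_eq: "gs n = scale (of_real (1 / sqrt (Re (F (gs_raw n) (gs_raw n))))) (gs_raw n)"
  by (subst gs.simps) (simp add: gs_raw_def Let_def)

lemma gs_raw_in_V: "gs_raw n \<in> V" and gs_in_V: "gs n \<in> V"
proof -
  have "gs_raw n \<in> V \<and> gs n \<in> V"
  proof (induction n rule: less_induct)
    case (less n)
    then have "gs_raw n \<in> V" unfolding gs_raw_def by (intro V_intros b_in_V) auto
    then show ?case by (simp add: gs_eq V_intros)
  qed
  then show "gs_raw n \<in> V" "gs n \<in> V" by auto
qed

lemma gs_normed: "F (gs n) (gs n) = 1 \<or> gs n = 0"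
proof (cases "Re (F (gs_raw n) (gs_raw n)) = 0")
  case True
  then show ?thesis by (simp add: gs_eq)
next
  case False
  define r where "r = Re (F (gs_raw n) (gs_raw n))"
  have r: "r > 0" using False F_nonneg[OF gs_raw_in_V[of n]] by (simp add: r_def)
  have "F (gs n) (gs n) = of_real (1 / sqrt r) * (of_real (1 / sqrt r) * of_real r)"
    using F_self[OF gs_raw_in_V[of n]] gs_raw_in_V[of n]
    by (simp add: gs_eq F_scale F_scale_right V_intros r_def)
  also have "\<dots> = of_real ((1 / sqrt r) * ((1 / sqrt r) * r))" by (simp only: of_real_mult)
  also have "(1 / sqrt r) * ((1 / sqrt r) * r) = 1" using r by (simp add: field_simps)
  finally show ?thesis by simp
qed

text \<open>Treats the normalized vectors and the inserted zeros alike, so that later sums need no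
  case distinction.\<close>

lemma F_gs_self: "x \<in> V \<Longrightarrow> F x (gs n) * F (gs n) (gs n) = F x (gs n)"
  using gs_normed[of n] F_commute[of 0 x] F_zero[of x] V_intros(1) by auto

lemma gs_orthogonal_less: "j < n \<Longrightarrow> F (gs n) (gs j) = 0"
proof (induction n arbitrary: j rule: less_induct)
  case (less n)
  have orth: "F (gs k) (gs j) = 0" if "k < n" "k \<noteq> j" for k
  proof (cases "j < k")
    case True then show ?thesis using less.IH[of k j] that by simp
  next
    case False
    then have "F (gs j) (gs k) = 0" using less.IH[of j k] that less.prems by simp
    then show ?thesis using F_commute[OF gs_in_V[of j] gs_in_V[of k]] by simp
  qed
  have "F (gs_raw n) (gs j) = F (b n) (gs j) - (\<Sum>k<n. F (b n) (gs k) * F (gs k) (gs j))"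
    unfolding gs_raw_def by (simp add: F_diff F_sum F_scale V_intros gs_in_V b_in_V)
  also have "(\<Sum>k<n. F (b n) (gs k) * F (gs k) (gs j)) = (\<Sum>k<n. if k = j then F (b n) (gs j) else 0)"
    using orth by (intro sum.cong refl) (auto simp: F_gs_self b_in_V)
  also have "\<dots> = F (b n) (gs j)" using less.prems by simp
  finally show ?case by (subst gs_eq) (simp add: F_scale gs_raw_in_V gs_in_V)
qed

lemma gs_orthogonal: "j \<noteq> n \<Longrightarrow> F (gs n) (gs j) = 0"
  using gs_orthogonal_less[of j n] gs_orthogonal_less[of n j] F_commute[OF gs_in_V[of j] gs_in_V[of n]]
  by (cases "j < n") auto

text \<open>\<open>V\<close> is the algebraic span of \<open>b\<close>, so finite expansions suffice
  and no convergence is involved. Equality is required only modulo \<open>null\<close>, since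
  Gram--Schmidt has discarded the null vectors.\<close>

definition expands :: "'v \<Rightarrow> nat \<Rightarrow> bool" where
  "expands x M \<longleftrightarrow> x \<in> V \<and> x - (\<Sum>k<M. scale (F x (gs k)) (gs k)) \<in> null"

lemma expands_iff:
  "expands x M \<longleftrightarrow> x \<in> V \<and> (\<forall>y\<in>V. F x y = (\<Sum>k<M. F x (gs k) * F (gs k) y))"
proof (cases "x \<in> V")
  case True
  then have "F (x - (\<Sum>k<M. scale (F x (gs k)) (gs k))) y = F x y - (\<Sum>k<M. F x (gs k) * F (gs k) y)"
    if "y \<in> V" for y
    using that by (simp add: F_diff F_sum F_scale V_intros gs_in_V)
  then show ?thesis using True by (auto simp: expands_def null_iff V_intros gs_in_V)
qed (simp add: expands_def)

lemma expands_coeff_0: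
  assumes "expands x M" "k \<ge> M"
  shows "F x (gs k) = 0"
proof -
  have "F x (gs k) = (\<Sum>j<M. F x (gs j) * F (gs j) (gs k))"
    using assms(1) by (simp add: expands_iff gs_in_V)
  also have "\<dots> = 0" using assms(2) by (intro sum.neutral) (auto simp: gs_orthogonal)
  finally show ?thesis .
qed

lemma expands_mono:
  assumes "expands x M" "M \<le> M'"
  shows "expands x M'"
proof -
  have "(\<Sum>k<M'. F x (gs k) * F (gs k) y) = (\<Sum>k<M. F x (gs k) * F (gs k) y)" for y
    using assms by (intro sum.mono_neutral_right) (auto simp: expands_coeff_0)
  then show ?thesis using assms(1) by (simp add: expands_iff)
qed

text \<open>Subtracting the component along \<open>gs n\<close> from \<open>gs_raw n\<close> leaves
  0 if \<open>gs_raw n\<close> has positive length. Otherwise \<open>gs n\<close> is 0 and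
  \<open>gs_raw n\<close> is itself the null remainder.\<close>

lemma expands_b: "expands (b n) (Suc n)"
proof -
  let ?w = "gs_raw n"
  have eq: "b n - (\<Sum>k<Suc n. scale (F (b n) (gs k)) (gs k)) = ?w - scale (F (b n) (gs n)) (gs n)"
    by (simp add: gs_raw_def)
  have "F (\<Sum>k<n. scale (F (b n) (gs k)) (gs k)) (gs n) = 0"
    by (simp add: F_sum F_scale V_intros gs_in_V gs_orthogonal)
  then have bw: "F (b n) (gs n) = F ?w (gs n)"
    unfolding gs_raw_def by (simp add: F_diff V_intros gs_in_V b_in_V)
  have "?w - scale (F (b n) (gs n)) (gs n) \<in> null"
  proof (cases "Re (F ?w ?w) = 0")
    case True
    then have "gs n = 0" "F ?w ?w = 0" using F_self[OF gs_raw_in_V[of n]] by (simp_all add: gs_eq)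
    then show ?thesis by (simp add: null_def gs_raw_in_V)
  next
    case False
    define r where "r = Re (F ?w ?w)"
    have r: "r > 0" using False F_nonneg[OF gs_raw_in_V[of n]] by (simp add: r_def)
    have gs: "gs n = scale (of_real (1 / sqrt r)) ?w" unfolding r_def by (rule gs_eq)
    have c: "F ?w (gs n) = of_real (1 / sqrt r) * of_real r"
      using F_self[OF gs_raw_in_V[of n]] by (simp add: gs F_scale_right gs_raw_in_V r_def)
    have "scale (F (b n) (gs n)) (gs n) = scale (of_real (1 / sqrt r * r * (1 / sqrt r))) ?w"
      unfolding bw c by (subst gs) (simp only: scale_scale of_real_mult)
    also have "1 / sqrt r * r * (1 / sqrt r) = 1" using r by (simp add: field_simps)
    finally show ?thesis by (simp add: null_def F_zero V_intros)
  qed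
  then show ?thesis unfolding expands_def eq by (simp add: b_in_V)
qed

lemma expands_linear:
  assumes "expands x M" "expands y M"
  shows "expands (x + y) M" "expands (scale c x) M"
  using assms by (simp_all add: expands_iff V_intros F_add F_scale gs_in_V algebra_simps sum.distrib sum_distrib_left)

lemma expands_exists:
  assumes "x \<in> V"
  obtains M where "expands x M"
proof -
  have "span (range b) \<subseteq> {x. \<exists>M. expands x M}"
  proof (rule span_minimal)
    show "range b \<subseteq> {x. \<exists>M. expands x M}" using expands_b by blast
    show "subspace {x. \<exists>M. expands x M}"
    proof (rule subspaceI)
      show "0 \<in> {x. \<exists>M. expands x M}"
        by (auto simp: expands_iff V_intros F_zero intro!: exI[of _ 0])
    next
      fix x y assume "x \<in> {x. \<exists>M. expands x M}" "y \<in> {x. \<exists>M. expands x M}"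
      then obtain M M' where "expands x M" "expands y M'" by auto
      then have "expands x (max M M')" "expands y (max M M')" by (auto intro: expands_mono)
      then show "x + y \<in> {x. \<exists>M. expands x M}" using expands_linear by blast
    qed (use expands_linear in blast)
  qed
  then show thesis using assms that unfolding b_span by blast
qed

text \<open>The functional coded by the coefficient sequence \<open>h\<close>. It is linear in
  \<open>h\<close>, without conjugation. For \<open>x\<close> in \<open>V\<close> only finitely many
  coefficients of \<open>x\<close> are nonzero, so every sequence defines a linear functional on
  \<open>V\<close>; square-summability of \<open>h\<close> enters only for its boundedness. The
  index set depends on \<open>x\<close> alone, hence linearity in \<open>h\<close> holds
  unconditionally.\<close>

definition pairing :: "(nat \<Rightarrow> complex) \<Rightarrow> 'v \<Rightarrow> complex" where
  "pairing h x = (\<Sum>k | F x (gs k) \<noteq> 0. h k * F x (gs k))"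

lemma pairing_eq:
  assumes "expands x M"
  shows "pairing h x = (\<Sum>k<M. h k * F x (gs k))"
  unfolding pairing_def
proof (rule sum.mono_neutral_left)
  show "{k. F x (gs k) \<noteq> 0} \<subseteq> {..<M}"
    using expands_coeff_0[OF assms] not_le by auto
qed auto

lemma pairing_add:
  assumes "x \<in> V" "y \<in> V"
  shows "pairing h (x + y) = pairing h x + pairing h y"
proof -
  obtain M M' where "expands x M" "expands y M'" using assms expands_exists by metis
  then have e: "expands x (max M M')" "expands y (max M M')" by (auto intro: expands_mono)
  show ?thesis
    unfolding pairing_eq[OF e(1)] pairing_eq[OF e(2)] pairing_eq[OF expands_linear(1)[OF e]]
    using assms by (simp add: F_add gs_in_V sum.distrib algebra_simps)
qed

lemma pairing_scale:
  assumes "x \<in> V"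
  shows "pairing h (scale c x) = c * pairing h x"
proof -
  obtain M where e: "expands x M" using assms expands_exists by blast
  show ?thesis
    unfolding pairing_eq[OF e] pairing_eq[OF expands_linear(2)[OF e e]]
    using assms by (simp add: F_scale gs_in_V algebra_simps sum_distrib_left)
qed

lemma pairing_0: "pairing h 0 = 0"
  using pairing_scale[of 0 h 0] V_intros by simp

lemma pairing_sum:
  assumes "\<And>a. a \<in> A \<Longrightarrow> f a \<in> V"
  shows "pairing h (\<Sum>a\<in>A. f a) = (\<Sum>a\<in>A. pairing h (f a))"
  using assms by (induction A rule: infinite_finite_induct) (auto simp: pairing_0 pairing_add V_intros)

lemma pairing_null: "x \<in> null \<Longrightarrow> pairing h x = 0"
  by (simp add: pairing_def null_iff gs_in_V)

lemma parseval:
  assumes "expands x M"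
  shows "(\<Sum>k<M. (cmod (F x (gs k)))\<^sup>2) = Re (F x x)"
proof -
  have x: "x \<in> V" using assms by (simp add: expands_iff)
  have "F x x = (\<Sum>k<M. F x (gs k) * F (gs k) x)" using assms x by (simp add: expands_iff)
  also have "\<dots> = (\<Sum>k<M. of_real ((cmod (F x (gs k)))\<^sup>2))"
    using F_commute[OF x gs_in_V] by (simp add: complex_norm_square[symmetric])
  finally show ?thesis by simp
qed

lemma pairing_bound:
  assumes "h \<in> ell2" "x \<in> V"
  shows "cmod (pairing h x) \<le> ell2_norm h * sqrt (Re (F x x))"
proof -
  obtain M where M: "expands x M" using assms expands_exists by blast
  have "cmod (pairing h x) \<le> (\<Sum>k<M. \<bar>cmod (h k)\<bar> * \<bar>cmod (F x (gs k))\<bar>)"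
    unfolding pairing_eq[OF M] by (rule order_trans[OF norm_sum]) (simp add: norm_mult)
  also have "\<dots> \<le> L2_set (\<lambda>k. cmod (h k)) {..<M} * L2_set (\<lambda>k. cmod (F x (gs k))) {..<M}"
    by (rule L2_set_mult_ineq)
  also have "\<dots> \<le> ell2_norm h * sqrt (Re (F x x))"
  proof (rule mult_mono)
    show "L2_set (\<lambda>k. cmod (h k)) {..<M} \<le> ell2_norm h"
      unfolding L2_set_def by (intro real_le_lsqrt sum_le_ell2_norm ell2_norm_nonneg assms)
  qed (simp_all add: L2_set_def parseval[OF M] ell2_norm_nonneg assms F_nonneg sum_nonneg)
  finally show ?thesis .
qed

lemma pairing_linear_left:
  "pairing (\<lambda>k. h k + g k) x = pairing h x + pairing g x"
  "pairing (\<lambda>k. c * h k) x = c * pairing h x"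
  by (simp_all add: pairing_def algebra_simps sum.distrib sum_distrib_left)

lemma pairing_sum_left: "pairing (\<lambda>k. \<Sum>a\<in>A. f a k) x = (\<Sum>a\<in>A. pairing (f a) x)"
  unfolding pairing_def sum_distrib_right by (rule sum.swap)

text \<open>The Riesz correspondence. The arguments of \<open>F\<close> are in this order so that
  \<open>coords y\<close> codes the functional \<open>F x y\<close> of \<open>x\<close>; the
  dependence on \<open>y\<close> is conjugate-linear.\<close>

definition coords :: "'v \<Rightarrow> nat \<Rightarrow> complex" where
  "coords y = (\<lambda>k. F (gs k) y)"

lemma coords_ell2:
  assumes "y \<in> V"
  shows "coords y \<in> ell2" "(ell2_norm (coords y))\<^sup>2 = Re (F y y)"
proof -
  obtain M where M: "expands y M" using assms expands_exists by blast
  have c: "coords y = (\<lambda>k. cnj (F y (gs k)))"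
    using F_commute[OF assms gs_in_V] by (simp add: coords_def)
  have "coords y k = 0" if "k \<ge> M" for k using expands_coeff_0[OF M that] by (simp add: c)
  note fs = ell2_finite_support[of M "coords y", OF this]
  show "coords y \<in> ell2" by (rule fs)
  show "(ell2_norm (coords y))\<^sup>2 = Re (F y y)"
    using fs(2) parseval[OF M] by (simp add: c)
qed

lemma pairing_coords: "x \<in> V \<Longrightarrow> y \<in> V \<Longrightarrow> pairing (coords y) x = F x y"
  using expands_exists[of x] by (metis (no_types, lifting) coords_def expands_iff mult.commute pairing_eq sum.cong)

text \<open>The transpose of \<open>S\<close>: its values are those of the functional coded by
  \<open>h\<close>, composed with \<open>S\<close>, on the orthonormal sequence. It is linear in
  \<open>S\<close> and in \<open>h\<close>.\<close>

definition adj :: "('v \<Rightarrow> 'v) \<Rightarrow> (nat \<Rightarrow> complex) \<Rightarrow> nat \<Rightarrow> complex" where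
  "adj S h = (\<lambda>k. pairing h (S (gs k)))"

end

section \<open>Contractions and their transposes\<close>

locale contraction_on = separable_semi_inner_product scale V F b
  for scale :: "complex \<Rightarrow> 'v::ab_group_add \<Rightarrow> 'v" and V F b +
  fixes S :: "'v \<Rightarrow> 'v"
  assumes S_in_V: "x \<in> V \<Longrightarrow> S x \<in> V"
    and S_add: "x \<in> V \<Longrightarrow> y \<in> V \<Longrightarrow> S (x + y) = S x + S y"
    and S_scale: "x \<in> V \<Longrightarrow> S (scale c x) = scale c (S x)"
    and S_contraction: "x \<in> V \<Longrightarrow> Re (F (S x) (S x)) \<le> Re (F x x)"
begin

lemma S_0: "S 0 = 0" using S_scale[of 0 0] V_intros by simp

lemma S_sum:
  assumes "\<And>a. a \<in> A \<Longrightarrow> f a \<in> V"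
  shows "S (\<Sum>a\<in>A. f a) = (\<Sum>a\<in>A. S (f a))"
  using assms by (induction A rule: infinite_finite_induct) (auto simp: S_0 S_add V_intros)

text \<open>The sequence \<open>adj S h\<close> records values on the vectors \<open>gs k\<close>
  only. They determine the composed functional because expansions are exact modulo
  \<open>null\<close> and \<open>S\<close> does not lead out of \<open>null\<close>.\<close>

lemma S_null:
  assumes "x \<in> null"
  shows "S x \<in> null"
proof -
  have x: "x \<in> V" "F x x = 0" using assms by (auto simp: null_def)
  have "Re (F (S x) (S x)) = 0" using S_contraction[OF x(1)] F_nonneg[OF S_in_V[OF x(1)]] x(2) by simp
  then show ?thesis using F_self[OF S_in_V[OF x(1)]] S_in_V[OF x(1)] by (simp add: null_def)
qed

lemma pairing_adj:
  assumes "x \<in> V"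
  shows "pairing (adj S h) x = pairing h (S x)"
proof -
  obtain M where M: "expands x M" using assms expands_exists by blast
  define y where "y = (\<Sum>k<M. scale (F x (gs k)) (gs k))"
  have y: "y \<in> V" unfolding y_def by (intro V_intros gs_in_V)
  have n: "x - y \<in> null" using M by (simp add: expands_def y_def)
  have "S x = S (x - y) + S y" using S_add[of "x - y" y] assms y V_intros by simp
  then have "pairing h (S x) = pairing h (S (x - y)) + pairing h (S y)"
    using assms y V_intros by (simp add: pairing_add S_in_V)
  also have "\<dots> = pairing h (S y)" using pairing_null[OF S_null[OF n]] by simp
  also have "\<dots> = (\<Sum>k<M. F x (gs k) * pairing h (S (gs k)))"
    unfolding y_def by (simp add: S_sum S_scale V_intros gs_in_V S_in_V pairing_sum pairing_scale)
  also have "\<dots> = pairing (adj S h) x"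
    unfolding pairing_eq[OF M] by (simp add: adj_def mult.commute)
  finally show ?thesis ..
qed

text \<open>Duality. The functional coded by \<open>h\<close> is evaluated at \<open>S x\<close>,
  where \<open>x\<close> has the conjugates of the first \<open>n\<close> entries of
  \<open>adj S h\<close> as coefficients. The value is the partial sum \<open>A\<close>, and
  contractivity bounds it by the norm of \<open>h\<close> times \<open>sqrt A\<close>.\<close>

lemma adj_ell2:
  assumes h: "h \<in> ell2"
  shows "adj S h \<in> ell2" "ell2_norm (adj S h) \<le> ell2_norm h"
proof -
  have "(\<Sum>k<n. (cmod (adj S h k))\<^sup>2) \<le> (ell2_norm h)\<^sup>2" for n
  proof -
    define x where "x = (\<Sum>k<n. scale (cnj (adj S h k)) (gs k))"
    define A where "A = (\<Sum>k<n. (cmod (adj S h k))\<^sup>2)"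
    have A: "0 \<le> A" by (simp add: A_def sum_nonneg)
    have x: "x \<in> V" unfolding x_def by (intro V_intros gs_in_V)
    have Fx: "F x (gs k) = cnj (adj S h k) * F (gs k) (gs k)" if "k < n" for k
    proof -
      have "F x (gs k) = (\<Sum>j<n. cnj (adj S h j) * F (gs j) (gs k))"
        unfolding x_def by (simp add: F_sum F_scale V_intros gs_in_V)
      also have "\<dots> = (\<Sum>j<n. if j = k then cnj (adj S h k) * F (gs k) (gs k) else 0)"
        by (intro sum.cong refl) (auto simp: gs_orthogonal)
      finally show ?thesis using that by simp
    qed
    have "Re (F x x) \<le> A"
    proof -
      have "F x x = (\<Sum>k<n. cnj (adj S h k) * F (gs k) x)"
        by (subst (1) x_def) (simp add: F_sum F_scale V_intros gs_in_V x)
      also have "\<dots> = (\<Sum>k<n. of_real ((cmod (adj S h k))\<^sup>2) * cnj (F (gs k) (gs k)))"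
        using Fx F_commute[OF x gs_in_V] complex_norm_square[of "adj S h k" for k]
        by (intro sum.cong refl) (simp add: ac_simps)
      finally have "Re (F x x) = (\<Sum>k<n. (cmod (adj S h k))\<^sup>2 * Re (F (gs k) (gs k)))" by simp
      \<comment> \<open>The length of \<open>gs k\<close> is 1 or 0; an inserted zero can only
        decrease the sum.\<close>
      also have "\<dots> \<le> (\<Sum>k<n. (cmod (adj S h k))\<^sup>2 * 1)"
        using gs_normed F_zero[OF V_intros(1)] by (intro sum_mono mult_left_mono) (metis one_complex.sel(1) order_refl zero_complex.sel(1) zero_le_one, simp)
      finally show ?thesis by (simp add: A_def)
    qed
    moreover have "pairing h (S x) = of_real A"
    proof -
      have "pairing h (S x) = (\<Sum>k<n. cnj (adj S h k) * adj S h k)"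
        unfolding x_def by (simp add: S_sum S_scale V_intros gs_in_V S_in_V pairing_sum pairing_scale adj_def)
      also have "\<dots> = (\<Sum>k<n. of_real ((cmod (adj S h k))\<^sup>2))"
        by (intro sum.cong refl) (simp only: complex_norm_square mult.commute)
      finally show ?thesis by (simp add: A_def)
    qed
    moreover have "cmod (pairing h (S x)) \<le> ell2_norm h * sqrt (Re (F (S x) (S x)))"
      by (intro pairing_bound h S_in_V x)
    moreover have "\<dots> \<le> ell2_norm h * sqrt A"
      using S_contraction[OF x] \<open>Re (F x x) \<le> A\<close> by (intro mult_left_mono real_sqrt_le_mono ell2_norm_nonneg h) linarith
    ultimately have "sqrt A * sqrt A \<le> ell2_norm h * sqrt A" using A by simp
    then have "sqrt A \<le> ell2_norm h"
      using A ell2_norm_nonneg[OF h] mult_right_le_imp_le[of "sqrt A" "sqrt A"] by (cases "A = 0") auto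
    then have "(sqrt A)\<^sup>2 \<le> (ell2_norm h)\<^sup>2" using A by (intro power_mono) auto
    then show ?thesis using A by (simp add: A_def)
  qed
  from ell2I[OF this ell2_norm_nonneg[OF h]]
  show "adj S h \<in> ell2" "ell2_norm (adj S h) \<le> ell2_norm h" .
qed

end


subsection \<open>The cone of kernels\<close>

text \<open>The induction methods eta-expand functions in the goal, and these rules would then break up sums
  of functions.\<close>

declare plus_fun_apply [simp del] zero_fun_apply [simp del] minus_apply [simp del] uminus_apply [simp del]

definition fscale :: "complex \<Rightarrow> ('x \<Rightarrow> complex) \<Rightarrow> 'x \<Rightarrow> complex" where
  "fscale c f = (\<lambda>x. c * f x)"

text \<open>Separation takes place over the reals; the complex form is recovered from the real
  functional by polarization.\<close>

definition kscale :: "real \<Rightarrow> ('x \<Rightarrow> 'x \<Rightarrow> complex) \<Rightarrow> 'x \<Rightarrow> 'x \<Rightarrow> complex" where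
  "kscale r h = (\<lambda>x y. of_real r * h x y)"

definition outer :: "('x \<Rightarrow> complex) \<Rightarrow> ('x \<Rightarrow> complex) \<Rightarrow> 'x \<Rightarrow> 'x \<Rightarrow> complex" where
  "outer p q = (\<lambda>x y. p x * cnj (q y))"

lemmas fun_simps = fun_eq_iff plus_fun_apply zero_fun_apply minus_apply uminus_apply

lemmas kernel_simps = fscale_def kscale_def outer_def fun_simps

lemma vector_space_fscale: "vector_space fscale"
  by unfold_locales (auto simp: kernel_simps algebra_simps)

lemma vector_space_kscale: "vector_space kscale"
  by unfold_locales (auto simp: kernel_simps algebra_simps)

interpretation fs: vector_space fscale by (rule vector_space_fscale)

interpretation ks: vector_space kscale by (rule vector_space_kscale)

text \<open>Vector polynomials are functions of the point and the index of the component, so that an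
  \<open>'m \<times> 'm\<close> matrix-valued kernel becomes a scalar kernel.\<close>

definition unit_vec :: "'m \<Rightarrow> (nat \<Rightarrow> complex) \<times> 'm \<Rightarrow> complex" where
  "unit_vec k = (\<lambda>x. if snd x = k then 1 else 0)"

definition shift :: "nat \<Rightarrow> ((nat \<Rightarrow> complex) \<times> 'm \<Rightarrow> complex) \<Rightarrow> (nat \<Rightarrow> complex) \<times> 'm \<Rightarrow> complex" where
  "shift i p = (\<lambda>x. fst x i * p x)"

text \<open>Polynomial maps with values in the column vectors, presented by generators. Bounds and
  polynomiality of kernels can then be proved by induction on the construction, one variable at a
  time.\<close>

inductive_set vpolys :: "nat \<Rightarrow> ((nat \<Rightarrow> complex) \<times> 'm \<Rightarrow> complex) set" for N where
  unit: "unit_vec k \<in> vpolys N"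
| add: "p \<in> vpolys N \<Longrightarrow> q \<in> vpolys N \<Longrightarrow> p + q \<in> vpolys N"
| scale: "p \<in> vpolys N \<Longrightarrow> fscale c p \<in> vpolys N"
| shift: "p \<in> vpolys N \<Longrightarrow> i \<in> {1..N} \<Longrightarrow> shift i p \<in> vpolys N"

text \<open>Sums of squares are positive definite and polynomial by construction, so membership
  delivers both properties demanded of the kernels.\<close>

inductive_set sos :: "nat \<Rightarrow> ((nat \<Rightarrow> complex) \<times> 'm \<Rightarrow> (nat \<Rightarrow> complex) \<times> 'm \<Rightarrow> complex) set" for N where
  zero: "0 \<in> sos N"
| add_square: "h \<in> sos N \<Longrightarrow> p \<in> vpolys N \<Longrightarrow> h + outer p p \<in> sos N"

definition defect :: "nat \<Rightarrow> ((nat \<Rightarrow> complex) \<times> 'm \<Rightarrow> (nat \<Rightarrow> complex) \<times> 'm \<Rightarrow> complex) \<Rightarrow>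
    (nat \<Rightarrow> complex) \<times> 'm \<Rightarrow> (nat \<Rightarrow> complex) \<times> 'm \<Rightarrow> complex" where
  "defect i h = (\<lambda>x y. (1 - fst x i * cnj (fst y i)) * h x y)"

definition agler_cone :: "nat \<Rightarrow> ((nat \<Rightarrow> complex) \<times> 'm \<Rightarrow> (nat \<Rightarrow> complex) \<times> 'm \<Rightarrow> complex) set" where
  "agler_cone N = {K 0 + (\<Sum>i=1..N. defect i (K i)) | K. \<forall>i. K i \<in> sos N}"

text \<open>The constant kernel with value the identity matrix, written as a sum of squares. It is
  the order unit.\<close>

definition unit_kernel :: "(nat \<Rightarrow> complex) \<times> 'm::finite \<Rightarrow> (nat \<Rightarrow> complex) \<times> 'm \<Rightarrow> complex" where
  "unit_kernel = (\<Sum>k\<in>UNIV. outer (unit_vec k) (unit_vec k))"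

section \<open>Closure and order properties of the cone\<close>

lemma subspace_vpolys: "fs.subspace (vpolys N)"
proof (rule fs.subspaceI)
  have "fscale 0 (unit_vec k) \<in> vpolys N" for k :: 'a
    by (intro vpolys.intros)
  then show "(0 :: _ \<times> 'a \<Rightarrow> _) \<in> vpolys N" by simp
qed (auto intro: vpolys.intros)

lemma sos_square: "p \<in> vpolys N \<Longrightarrow> outer p p \<in> sos N"
  using sos.add_square[OF sos.zero] by simp

lemma sos_add: "g \<in> sos N \<Longrightarrow> h \<in> sos N \<Longrightarrow> g + h \<in> sos N"
proof (induction g rule: sos.induct)
  case (add_square g p)
  then have "(g + h) + outer p p \<in> sos N" by (intro sos.add_square) auto
  then show ?case by (simp add: algebra_simps)
qed simp

lemma sos_scale: "h \<in> sos N \<Longrightarrow> 0 \<le> r \<Longrightarrow> kscale r h \<in> sos N"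
proof (induction h rule: sos.induct)
  case zero
  then show ?case using sos.zero by (simp add: ks.scale_zero_right)
next
  case (add_square h p)
  have "outer (fscale (of_real (sqrt r)) p) (fscale (of_real (sqrt r)) p) = kscale r (outer p p)"
  proof -
    have "complex_of_real (sqrt r) * complex_of_real (sqrt r) = of_real r"
      using add_square.prems by (simp only: of_real_mult[symmetric]) simp
    then show ?thesis by (simp add: kernel_simps algebra_simps)
  qed
  moreover have "kscale r h + outer (fscale (of_real (sqrt r)) p) (fscale (of_real (sqrt r)) p) \<in> sos N"
    using add_square by (intro sos.add_square vpolys.scale) auto
  ultimately show ?case by (simp add: ks.scale_right_distrib)
qed

lemma sos_subset_agler_cone: "h \<in> sos N \<Longrightarrow> h \<in> agler_cone N"
  unfolding agler_cone_def
  by (intro CollectI exI[of _ "\<lambda>i. if i = 0 then h else 0"])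
    (auto simp: sos.zero defect_def fun_simps intro!: sum.neutral)

lemma defect_in_agler_cone:
  assumes "h \<in> sos N" "i \<in> {1..N}"
  shows "defect i h \<in> agler_cone N"
proof -
  have "(\<Sum>j=1..N. defect j (if j = i then h else 0)) = (\<Sum>j=1..N. if j = i then defect i h else 0)"
    by (intro sum.cong) (auto simp: defect_def fun_simps)
  also have "\<dots> = defect i h" using assms(2) by simp
  finally show ?thesis
    unfolding agler_cone_def using assms
    by (intro CollectI exI[of _ "\<lambda>j. if j = i then h else 0"]) (auto simp: sos.zero)
qed

lemma agler_cone_add:
  assumes "g \<in> agler_cone N" "h \<in> agler_cone N"
  shows "g + h \<in> agler_cone N"
proof -
  obtain K K' where K: "\<And>i. K i \<in> sos N" "g = K 0 + (\<Sum>i=1..N. defect i (K i))"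
    and K': "\<And>i. K' i \<in> sos N" "h = K' 0 + (\<Sum>i=1..N. defect i (K' i))"
    using assms by (auto simp: agler_cone_def)
  have "defect i (K i + K' i) = defect i (K i) + defect i (K' i)" for i
    by (simp add: defect_def fun_simps algebra_simps)
  then have "g + h = (K 0 + K' 0) + (\<Sum>i=1..N. defect i (K i + K' i))"
    by (simp add: K(2) K'(2) sum.distrib algebra_simps)
  then show ?thesis
    unfolding agler_cone_def using K(1) K'(1)
    by (intro CollectI exI[of _ "\<lambda>i. K i + K' i"]) (auto intro: sos_add)
qed

lemma agler_cone_scale:
  assumes "h \<in> agler_cone N" "0 \<le> r"
  shows "kscale r h \<in> agler_cone N"
proof -
  obtain K where K: "\<And>i. K i \<in> sos N" "h = K 0 + (\<Sum>i=1..N. defect i (K i))"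
    using assms by (auto simp: agler_cone_def)
  have "defect i (kscale r (K i)) = kscale r (defect i (K i))" for i
    by (simp add: defect_def kernel_simps)
  then have "kscale r h = kscale r (K 0) + (\<Sum>i=1..N. defect i (kscale r (K i)))"
    by (simp add: K(2) ks.scale_right_distrib ks.scale_sum_right)
  then show ?thesis
    unfolding agler_cone_def using K(1) assms(2)
    by (intro CollectI exI[of _ "\<lambda>i. kscale r (K i)"]) (auto intro: sos_scale)
qed

lemma unit_kernel_sos: "unit_kernel \<in> sos N"
proof -
  have "(\<Sum>k\<in>A. outer (unit_vec k) (unit_vec k)) \<in> sos N" if "finite A" for A :: "'m::finite set"
    using that by (induction A) (simp_all add: sos.zero sos_add sos_square vpolys.unit)
  then show ?thesis by (simp add: unit_kernel_def)
qed

lemma square_bounded: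
  "p \<in> vpolys N \<Longrightarrow> \<exists>M. kscale M unit_kernel - outer p p \<in> agler_cone N"
proof (induction p rule: vpolys.induct)
  case (unit k)
  have "(\<Sum>l\<in>A. outer (unit_vec l) (unit_vec l)) \<in> sos N" if "finite A" for A :: "'a set"
    using that by (induction A) (simp_all add: sos.zero sos_add sos_square vpolys.unit)
  moreover have "unit_kernel - outer (unit_vec k) (unit_vec k)
      = (\<Sum>l\<in>UNIV - {k}. outer (unit_vec l) (unit_vec l))"
    unfolding unit_kernel_def by (subst sum.remove[of UNIV k]) auto
  ultimately have "kscale 1 unit_kernel - outer (unit_vec k) (unit_vec k) \<in> agler_cone N"
    by (simp add: sos_subset_agler_cone)
  then show ?case by blast
next
  case (add p q)
  then obtain M M' where M: "kscale M unit_kernel - outer p p \<in> agler_cone N"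
    "kscale M' unit_kernel - outer q q \<in> agler_cone N" by auto
  \<comment> \<open>Parallelogram law: the squares of the sum and of the difference add up to twice
    the two given squares. Adding the square of \<open>p - q\<close> therefore turns the two bounds
    into one for \<open>p + q\<close>.\<close>
  let ?d = "p + fscale (- 1) q"
  have "?d \<in> vpolys N" using add by (intro vpolys.intros)
  then have "kscale 2 (kscale M unit_kernel - outer p p) + kscale 2 (kscale M' unit_kernel - outer q q)
      + outer ?d ?d \<in> agler_cone N"
    using M by (intro agler_cone_add agler_cone_scale) (auto intro: sos_subset_agler_cone sos_square)
  also have "kscale 2 (kscale M unit_kernel - outer p p) + kscale 2 (kscale M' unit_kernel - outer q q)
      + outer ?d ?d = kscale (2 * (M + M')) unit_kernel - outer (p + q) (p + q)"
    by (simp add: kernel_simps algebra_simps)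
  finally show ?case by blast
next
  case (scale p c)
  then obtain M where "kscale M unit_kernel - outer p p \<in> agler_cone N" by auto
  then have "kscale ((cmod c)\<^sup>2) (kscale M unit_kernel - outer p p) \<in> agler_cone N"
    by (rule agler_cone_scale) simp
  also have "kscale ((cmod c)\<^sup>2) (kscale M unit_kernel - outer p p)
      = kscale ((cmod c)\<^sup>2 * M) unit_kernel - outer (fscale c p) (fscale c p)"
    unfolding kernel_simps minus_apply by (simp add: of_real_mult complex_norm_square algebra_simps del: of_real_power)
  finally show ?case by blast
next
  case (shift p i)
  then obtain M where "kscale M unit_kernel - outer p p \<in> agler_cone N" by auto
  \<comment> \<open>The defect of a square is exactly the drop from the square of \<open>p\<close>
    to that of \<open>shift i p\<close>, so the same \<open>M\<close> works.\<close>
  then have "(kscale M unit_kernel - outer p p) + defect i (outer p p) \<in> agler_cone N"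
    using shift.hyps by (intro agler_cone_add defect_in_agler_cone sos_square)
  also have "(kscale M unit_kernel - outer p p) + defect i (outer p p)
      = kscale M unit_kernel - outer (shift i p) (shift i p)"
    by (simp add: kernel_simps defect_def shift_def algebra_simps)
  finally show ?case by blast
qed

text \<open>Each property of the form is the sign or value of the functional at one kernel: at
  squares for semidefiniteness, at defects of squares for contractivity of the shifts, at the order
  unit for the normalization, and at the separated kernel for the columns.\<close>

lemma separating_form:
  fixes P :: "'n::finite \<Rightarrow> (nat \<Rightarrow> complex) \<times> 'm::finite \<Rightarrow> complex"
  assumes P: "\<And>j. P j \<in> vpolys N"
    and notin: "unit_kernel - (\<Sum>j\<in>UNIV. outer (P j) (P j)) \<notin> agler_cone N"
  obtains F where "semi_inner_product fscale (vpolys N) F"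
    "\<And>i p. i \<in> {1..N} \<Longrightarrow> p \<in> vpolys N \<Longrightarrow> Re (F (shift i p) (shift i p)) \<le> Re (F p p)"
    "(\<Sum>k\<in>UNIV. Re (F (unit_vec k) (unit_vec k))) = 1"
    "(\<Sum>j\<in>UNIV. Re (F (P j) (P j))) \<ge> 1"
proof -
  let ?e = "unit_kernel :: (nat \<Rightarrow> complex) \<times> 'm \<Rightarrow> (nat \<Rightarrow> complex) \<times> 'm \<Rightarrow> complex"
  define B where "B = {y. \<exists>M. kscale M ?e - y \<in> agler_cone N \<and> kscale M ?e + y \<in> agler_cone N}"
  have eC: "?e \<in> agler_cone N" by (rule sos_subset_agler_cone[OF unit_kernel_sos])
  have B: "ks.subspace B"
    unfolding B_def by (intro order_unit_subspace vector_space_kscale agler_cone_add agler_cone_scale eC)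
  have square_B: "outer p p \<in> B" if p: "p \<in> vpolys N" for p
  proof -
    obtain M where M: "kscale M ?e - outer p p \<in> agler_cone N" using square_bounded[OF p] by blast
    \<comment> \<open>The given \<open>M\<close> carries no sign information. The second half of
      membership in \<open>B\<close>, with a plus sign, needs a nonnegative multiple.\<close>
    have "kscale (max M 0) ?e - outer p p = (kscale M ?e - outer p p) + kscale (max M 0 - M) ?e"
      by (simp add: kernel_simps algebra_simps)
    also have "\<dots> \<in> agler_cone N" by (intro agler_cone_add agler_cone_scale M eC) simp
    finally have 1: "kscale (max M 0) ?e - outer p p \<in> agler_cone N" .
    have 2: "kscale (max M 0) ?e + outer p p \<in> agler_cone N"
      by (intro agler_cone_add agler_cone_scale eC sos_subset_agler_cone sos_square p) simp
    show ?thesis unfolding B_def using 1 2 by blast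
  qed
  have e_B: "?e \<in> B"
    unfolding unit_kernel_def by (intro ks.subspace_sum B square_B vpolys.unit)
  have x_B: "?e - (\<Sum>j\<in>UNIV. outer (P j) (P j)) \<in> B"
    by (intro ks.subspace_diff ks.subspace_sum B square_B P e_B)
  have "\<exists>L. (\<forall>y\<in>B. \<forall>z\<in>B. L (y + z) = L y + L z) \<and> (\<forall>r. \<forall>y\<in>B. L (kscale r y) = r * L y) \<and>
      (\<forall>y\<in>B. y \<in> agler_cone N \<longrightarrow> 0 \<le> L y) \<and> L ?e = 1 \<and> L (?e - (\<Sum>j\<in>UNIV. outer (P j) (P j))) \<le> 0"
    by (rule cone_separation[OF vector_space_kscale agler_cone_add agler_cone_scale eC notin B_def x_B];
        (assumption | blast))
  then obtain L where L_add: "\<And>y z. y \<in> B \<Longrightarrow> z \<in> B \<Longrightarrow> L (y + z) = L y + L z"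
    and L_scale: "\<And>r y. y \<in> B \<Longrightarrow> L (kscale r y) = r * L y"
    and L_pos: "\<And>y. y \<in> B \<Longrightarrow> y \<in> agler_cone N \<Longrightarrow> 0 \<le> L y"
    and L_e: "L ?e = 1" and L_x: "L (?e - (\<Sum>j\<in>UNIV. outer (P j) (P j))) \<le> 0"
    by blast
  have L_diff: "L (y - z) = L y - L z" if "y \<in> B" "z \<in> B" for y z
    using L_add[of "y - z" z] ks.subspace_diff[OF B that] that by simp
  have L_sum: "L (\<Sum>a\<in>A. f a) = (\<Sum>a\<in>A. L (f a))" if "finite A" "\<And>a. a \<in> A \<Longrightarrow> f a \<in> B" for A and f :: "'z \<Rightarrow> _"
    using that
  proof (induction A)
    case empty
    show ?case using L_scale[OF e_B, of 0] by simp
  next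
    case (insert a A)
    then show ?case by (simp add: L_add ks.subspace_sum[OF B])
  qed
  \<comment> \<open>The functional is usable only on \<open>B\<close>. The symmetrized product lies
    there by polarization, being a combination of squares.\<close>
  define herm where "herm = (\<lambda>p q :: (nat \<Rightarrow> complex) \<times> 'm \<Rightarrow> complex. outer p q + outer q p)"
  have herm_B: "herm p q \<in> B" if "p \<in> vpolys N" "q \<in> vpolys N" for p q
  proof -
    have "herm p q = outer (p + q) (p + q) - outer p p - outer q q"
      by (simp add: herm_def kernel_simps algebra_simps)
    then show ?thesis using that by (simp only:) (intro ks.subspace_diff B square_B vpolys.add)
  qed
  \<comment> \<open>Replacing \<open>q\<close> by \<open>\<i> q\<close> turns the imaginary part of
    a sesquilinear form into a real part, which reconstructs the complex form from its real
    part.\<close>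
  define F where "F = (\<lambda>p q. Complex (L (herm p q) / 2) (L (herm p (fscale \<i> q)) / 2))"
  have Re_F: "Re (F p p) = L (outer p p)" if "p \<in> vpolys N" for p
  proof -
    have "herm p p = kscale 2 (outer p p)" by (simp add: herm_def kernel_simps)
    then show ?thesis using L_scale[OF square_B[OF that], of 2] by (simp add: F_def)
  qed
  have "semi_inner_product fscale (vpolys N) F"
  proof (intro semi_inner_product.intro vector_space_fscale semi_inner_product_axioms.intro subspace_vpolys)
    fix p q s :: "(nat \<Rightarrow> complex) \<times> 'm \<Rightarrow> complex" assume V: "p \<in> vpolys N" "q \<in> vpolys N" "s \<in> vpolys N"
    have "herm (p + q) t = herm p t + herm q t" for t
      by (simp add: herm_def kernel_simps algebra_simps)
    then show "F (p + q) s = F p s + F q s"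
      using V by (simp add: F_def L_add herm_B vpolys.scale complex_eq_iff add_divide_distrib)
  next
    fix p q :: "(nat \<Rightarrow> complex) \<times> 'm \<Rightarrow> complex" and c assume V: "p \<in> vpolys N" "q \<in> vpolys N"
    have 1: "herm (fscale c p) q = kscale (Re c) (herm p q) - kscale (Im c) (herm p (fscale \<i> q))"
      by (simp add: herm_def kernel_simps complex_eq_iff algebra_simps)
    have 2: "herm (fscale c p) (fscale \<i> q) = kscale (Re c) (herm p (fscale \<i> q)) + kscale (Im c) (herm p q)"
      by (simp add: herm_def kernel_simps complex_eq_iff algebra_simps)
    have in_B: "kscale r (herm p q) \<in> B" "kscale r (herm p (fscale \<i> q)) \<in> B" for r
      using V by (auto intro!: ks.subspace_scale B herm_B vpolys.scale)
    show "F (fscale c p) q = c * F p q"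
      unfolding F_def 1 2 L_diff[OF in_B] L_add[OF in_B(2,1)] using V
      by (simp add: L_scale herm_B vpolys.scale complex_eq_iff diff_divide_distrib add_divide_distrib)
  next
    fix p q :: "(nat \<Rightarrow> complex) \<times> 'm \<Rightarrow> complex" assume V: "p \<in> vpolys N" "q \<in> vpolys N"
    have 1: "herm q p = herm p q" by (simp add: herm_def add.commute)
    have 2: "herm q (fscale \<i> p) = kscale (- 1) (herm p (fscale \<i> q))"
      by (simp add: herm_def kernel_simps algebra_simps)
    have 3: "L (herm q (fscale \<i> p)) = - 1 * L (herm p (fscale \<i> q))"
      unfolding 2 using V by (intro L_scale herm_B vpolys.scale)
    show "F q p = cnj (F p q)"
      unfolding F_def 1 3 by (simp add: complex_eq_iff)
  next
    fix p :: "(nat \<Rightarrow> complex) \<times> 'm \<Rightarrow> complex" assume V: "p \<in> vpolys N"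
    show "0 \<le> Re (F p p)"
      unfolding Re_F[OF V] by (intro L_pos square_B sos_subset_agler_cone sos_square V)
  qed
  moreover have "Re (F (shift i p) (shift i p)) \<le> Re (F p p)" if "i \<in> {1..N}" "p \<in> vpolys N" for i p
  proof -
    have sp: "shift i p \<in> vpolys N" using that by (intro vpolys.shift)
    have "outer p p - outer (shift i p) (shift i p) = defect i (outer p p)"
      by (simp add: kernel_simps shift_def defect_def algebra_simps)
    also have "\<dots> \<in> agler_cone N" using that by (intro defect_in_agler_cone sos_square)
    finally have "0 \<le> L (outer p p - outer (shift i p) (shift i p))"
      by (rule L_pos[rotated]) (intro ks.subspace_diff B square_B that sp)
    then show ?thesis using that sp by (simp add: Re_F L_diff square_B)
  qed
  moreover have "(\<Sum>k\<in>UNIV. Re (F (unit_vec k) (unit_vec k))) = 1"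
    using L_e unfolding unit_kernel_def by (simp add: L_sum square_B Re_F vpolys.unit)
  moreover have "(\<Sum>j\<in>UNIV. Re (F (P j) (P j))) \<ge> 1"
    using L_x by (simp add: L_diff L_sum e_B square_B ks.subspace_sum B P Re_F L_e)
  ultimately show thesis by (rule that)
qed

text \<open>Words of shifts applied to unit vectors give a countable spanning family, as required
  for Gram--Schmidt. One monomial arises from several words, which does not affect
  countability.\<close>

definition monomials :: "nat \<Rightarrow> ((nat \<Rightarrow> complex) \<times> 'm \<Rightarrow> complex) set" where
  "monomials N = {foldr shift is (unit_vec k) | is k. is \<in> lists {1..N}}"

lemma countable_monomials: "countable (monomials N :: (_ \<times> 'm::finite \<Rightarrow> _) set)"
proof -
  have "monomials N = (\<Union>k. (\<lambda>is. foldr shift is (unit_vec (k :: 'm))) ` lists {1..N})"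
    unfolding monomials_def by blast
  moreover have "countable (UNIV :: 'm set)" by (simp add: countable_finite)
  ultimately show ?thesis by (simp only:) (intro countable_UN countable_image countable_lists countableI_type)
qed

lemma shift_add: "shift i (p + q) = shift i p + shift i q"
  by (simp add: shift_def fun_simps algebra_simps)

lemma shift_fscale: "shift i (fscale c p) = fscale c (shift i p)"
  by (simp add: shift_def fscale_def fun_simps)

lemma shift_commute: "shift i (shift j p) = shift j (shift i p)"
  by (simp add: shift_def fun_simps)

lemma unit_vec_monomial: "unit_vec k \<in> monomials N"
  unfolding monomials_def by (intro CollectI exI[of _ "[]"] exI[of _ k]) simp

lemma shift_monomial:
  assumes "p \<in> monomials N" "i \<in> {1..N}"
  shows "shift i p \<in> monomials N"
proof -
  obtain "is" k where "p = foldr shift is (unit_vec k)" "is \<in> lists {1..N}"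
    using assms(1) unfolding monomials_def by blast
  then show ?thesis
    unfolding monomials_def using assms(2)
    by (intro CollectI exI[of _ "i # is"] exI[of _ k] conjI lists.Cons) simp_all
qed

lemma monomials_induct [consumes 1, case_names unit shift]:
  assumes "p \<in> monomials N" "\<And>k. Q (unit_vec k)"
    "\<And>p i. p \<in> monomials N \<Longrightarrow> Q p \<Longrightarrow> i \<in> {1..N} \<Longrightarrow> Q (shift i p)"
  shows "Q p"
proof -
  obtain "is" k where p: "p = foldr shift is (unit_vec k)" and l: "is \<in> lists {1..N}"
    using assms(1) unfolding monomials_def by blast
  from l have "foldr shift is (unit_vec k) \<in> monomials N \<and> Q (foldr shift is (unit_vec k))"
  proof (induction "is" rule: lists.induct)
    case Nil
    show ?case using assms(2) by (simp add: unit_vec_monomial)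
  next
    case (Cons i l)
    then show ?case using assms(3) by (simp add: shift_monomial)
  qed
  then show ?thesis using p by simp
qed

text \<open>The step that needs an argument is closure of the span under shifts: the functions whose
  shift lies in the span form a subspace that contains every monomial.\<close>

lemma span_monomials: "fs.span (monomials N :: (_ \<times> 'm \<Rightarrow> _) set) = vpolys N"
proof
  let ?M = "monomials N :: (_ \<times> 'm \<Rightarrow> _) set"
  have "p \<in> vpolys N" if "p \<in> ?M" for p
    using that by (induction rule: monomials_induct) (fact vpolys.unit, rule vpolys.shift)
  then show "fs.span ?M \<subseteq> vpolys N" by (intro fs.span_minimal subspace_vpolys subsetI)
  have span_shift: "fs.span ?M \<subseteq> {p. shift i p \<in> fs.span ?M}" if "i \<in> {1..N}" for i
  proof (rule fs.span_minimal)
    show "?M \<subseteq> {p. shift i p \<in> fs.span ?M}"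
      using that by (intro subsetI CollectI fs.span_base shift_monomial)
    have "shift i (0 :: _ \<times> 'm \<Rightarrow> _) = 0" by (simp add: shift_def fun_simps)
    then show "fs.subspace {p. shift i p \<in> fs.span ?M}"
      by (intro fs.subspaceI) (simp_all add: shift_add shift_fscale fs.span_zero fs.span_add fs.span_scale)
  qed
  show "vpolys N \<subseteq> fs.span ?M"
  proof
    fix p :: "_ \<times> 'm \<Rightarrow> _" assume "p \<in> vpolys N"
    then show "p \<in> fs.span ?M"
    proof (induction p rule: vpolys.induct)
      case (unit k)
      show ?case by (intro fs.span_base unit_vec_monomial)
    next
      case (shift p i)
      then show ?case using span_shift by blast
    qed (simp_all add: fs.span_add fs.span_scale)
  qed
qed


subsection \<open>Lower bound for the universal norm\<close>

lemma sum_fun_apply: "(\<Sum>a\<in>A. f a) x = (\<Sum>a\<in>A. f a x)"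
  by (induction A rule: infinite_finite_induct) (simp_all add: fun_simps)

section \<open>Multiplication by monomials and polynomials\<close>

definition mono_mult :: "(nat \<Rightarrow>\<^sub>0 nat) \<Rightarrow> ((nat \<Rightarrow> complex) \<times> 'm \<Rightarrow> complex) \<Rightarrow> (nat \<Rightarrow> complex) \<times> 'm \<Rightarrow> complex" where
  "mono_mult \<alpha> p = (\<lambda>x. (\<Prod>v\<in>Poly_Mapping.keys \<alpha>. fst x v ^ Poly_Mapping.lookup \<alpha> v) * p x)"

definition poly_mult :: "nat cpoly \<Rightarrow> ((nat \<Rightarrow> complex) \<times> 'm \<Rightarrow> complex) \<Rightarrow> (nat \<Rightarrow> complex) \<times> 'm \<Rightarrow> complex" where
  "poly_mult f p = (\<lambda>x. eval_poly f (fst x) * p x)"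

definition poly_column :: "nat cpoly^'n^'m \<Rightarrow> 'n \<Rightarrow> (nat \<Rightarrow> complex) \<times> 'm \<Rightarrow> complex" where
  "poly_column P j = (\<lambda>x. eval_poly (P $ snd x $ j) (fst x))"

lemma funpow_shift: "(shift i ^^ n) p = (\<lambda>x. fst x i ^ n * p x)"
  by (induction n) (simp_all add: shift_def fun_simps)

lemma funpow_shift_vpolys: "i \<in> {1..N} \<Longrightarrow> p \<in> vpolys N \<Longrightarrow> (\<lambda>x. fst x i ^ n * p x) \<in> vpolys N"
  unfolding funpow_shift[symmetric] by (induction n) (simp_all add: vpolys.shift)

lemma mono_mult_vpolys:
  assumes "Poly_Mapping.keys \<alpha> \<subseteq> {1..N}" "p \<in> vpolys N"
  shows "mono_mult \<alpha> p \<in> vpolys N"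
proof -
  have "(\<lambda>x. (\<Prod>v\<in>A. fst x v ^ Poly_Mapping.lookup \<alpha> v) * p x) \<in> vpolys N" if "finite A" "A \<subseteq> {1..N}" for A
    using that
  proof (induction A)
    case empty
    then show ?case using assms(2) by simp
  next
    case (insert v A)
    then have "(\<lambda>x. fst x v ^ Poly_Mapping.lookup \<alpha> v * ((\<Prod>v\<in>A. fst x v ^ Poly_Mapping.lookup \<alpha> v) * p x)) \<in> vpolys N"
      by (intro funpow_shift_vpolys) auto
    then show ?case using insert.hyps by (simp add: mult.assoc)
  qed
  then show ?thesis using assms(1) by (simp add: mono_mult_def)
qed

lemma poly_mult_eq:
  "poly_mult f p = (\<Sum>\<alpha>\<in>Poly_Mapping.keys f. fscale (Poly_Mapping.lookup f \<alpha>) (mono_mult \<alpha> p))"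
  by (simp add: fun_eq_iff poly_mult_def eval_poly_def fscale_def mono_mult_def sum_fun_apply sum_distrib_right mult.assoc)

lemma poly_mult_vpolys: "f \<in> polys_in {1..N} \<Longrightarrow> p \<in> vpolys N \<Longrightarrow> poly_mult f p \<in> vpolys N"
  unfolding poly_mult_eq polys_in_def
  by (intro fs.subspace_sum subspace_vpolys vpolys.scale mono_mult_vpolys) auto

text \<open>Displays the columns of \<open>P\<close> as the transpose of \<open>P\<close>, evaluated
  at the shifts and applied to the tuple of unit vectors.\<close>

lemma poly_column_eq:
  fixes P :: "nat cpoly^'n^'m::finite"
  shows "poly_column P j = (\<Sum>k\<in>UNIV. poly_mult (P $ k $ j) (unit_vec k))"
proof
  fix x :: "(nat \<Rightarrow> complex) \<times> 'm"
  have "(\<Sum>k\<in>UNIV. poly_mult (P $ k $ j) (unit_vec k)) x = (\<Sum>k\<in>UNIV. if k = snd x then poly_column P j x else 0)"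
    unfolding sum_fun_apply by (intro sum.cong) (auto simp: poly_mult_def unit_vec_def poly_column_def)
  then show "poly_column P j x = (\<Sum>k\<in>UNIV. poly_mult (P $ k $ j) (unit_vec k)) x" by simp
qed

lemma poly_column_vpolys:
  fixes P :: "nat cpoly^'n^'m::finite"
  assumes "\<And>i j. P $ i $ j \<in> polys_in {1..N}"
  shows "poly_column P j \<in> vpolys N"
  unfolding poly_column_eq by (intro fs.subspace_sum subspace_vpolys poly_mult_vpolys assms vpolys.unit)

section \<open>The scaled transposed shifts\<close>

locale agler_form =
  separable_semi_inner_product fscale "vpolys N" F b
  for N :: nat and F :: "((nat \<Rightarrow> complex) \<times> 'm::finite \<Rightarrow> complex) \<Rightarrow> ((nat \<Rightarrow> complex) \<times> 'm \<Rightarrow> complex) \<Rightarrow> complex"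
    and b +
  fixes r :: real
  assumes shift_contraction: "i \<in> {1..N} \<Longrightarrow> p \<in> vpolys N \<Longrightarrow> Re (F (shift i p) (shift i p)) \<le> Re (F p p)"
    and unit_norm: "(\<Sum>k\<in>UNIV. Re (F (unit_vec k) (unit_vec k))) = 1"
    and r: "0 \<le> r" "r < 1"
begin

lemma contraction_on_shift: "i \<in> {1..N} \<Longrightarrow> contraction_on fscale (vpolys N) F b (shift i)"
  by unfold_locales (simp_all add: vpolys.shift shift_add shift_fscale shift_contraction)

text \<open>Transposed shifts have norm at most 1 only; the factor \<open>r\<close> makes the
  contractions strict.\<close>

definition T :: "nat \<Rightarrow> (nat \<Rightarrow> complex) \<Rightarrow> nat \<Rightarrow> complex" where
  "T i h = (\<lambda>k. of_real r * adj (shift i) h k)"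

lemma T_ell2: "i \<in> {1..N} \<Longrightarrow> h \<in> ell2 \<Longrightarrow> T i h \<in> ell2"
  unfolding T_def by (intro ell2_scale contraction_on.adj_ell2[OF contraction_on_shift])

lemma pairing_T:
  "i \<in> {1..N} \<Longrightarrow> q \<in> vpolys N \<Longrightarrow> pairing (T i h) q = of_real r * pairing h (shift i q)"
  by (simp add: T_def pairing_linear_left contraction_on.pairing_adj[OF contraction_on_shift])

lemma funpow_T:
  assumes "i \<in> {1..N}" "h \<in> ell2"
  shows "(T i ^^ n) h \<in> ell2"
    "q \<in> vpolys N \<Longrightarrow> pairing ((T i ^^ n) h) q = of_real r ^ n * pairing h (\<lambda>x. fst x i ^ n * q x)"
proof -
  show "(T i ^^ n) h \<in> ell2" using assms by (induction n) (simp_all add: T_ell2)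
  show "pairing ((T i ^^ n) h) q = of_real r ^ n * pairing h (\<lambda>x. fst x i ^ n * q x)" if "q \<in> vpolys N"
    using that
  proof (induction n arbitrary: q)
    case (Suc n)
    have "shift i q \<in> vpolys N" using Suc.prems assms(1) by (rule vpolys.shift)
    from Suc.IH[OF this] show ?case
      using Suc.prems assms(1) by (simp add: pairing_T) (simp add: shift_def ac_simps)
  qed simp
qed

text \<open>Each application of an operator \<open>T i\<close> can be moved to the test vector,
  where it becomes multiplication by the variable and a factor \<open>r\<close>. The exponent of
  \<open>r\<close> is thus the total degree.\<close>

lemma monomial_op_T:
  assumes "h \<in> ell2"
  shows "monomial_op N T \<alpha> h \<in> ell2"
    "q \<in> vpolys N \<Longrightarrow> Poly_Mapping.keys \<alpha> \<subseteq> {1..N} \<Longrightarrow> pairing (monomial_op N T \<alpha> h) q =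
       of_real r ^ (\<Sum>i\<leftarrow>[1..<Suc N]. Poly_Mapping.lookup \<alpha> i) * pairing h (mono_mult \<alpha> q)"
proof -
  define A where "A = (\<lambda>L. foldr (\<lambda>i A. (T i ^^ Poly_Mapping.lookup \<alpha> i) \<circ> A) L id)"
  have A: "A L h \<in> ell2 \<and> (\<forall>q\<in>vpolys N. (\<lambda>x. (\<Prod>i\<leftarrow>L. fst x i ^ Poly_Mapping.lookup \<alpha> i) * q x) \<in> vpolys N \<and>
      pairing (A L h) q = of_real r ^ (\<Sum>i\<leftarrow>L. Poly_Mapping.lookup \<alpha> i) *
        pairing h (\<lambda>x. (\<Prod>i\<leftarrow>L. fst x i ^ Poly_Mapping.lookup \<alpha> i) * q x))"
    if "set L \<subseteq> {1..N}" for L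
    using that
  proof (induction L)
    case Nil
    then show ?case using assms by (simp add: A_def)
  next
    case (Cons i L)
    have AC: "A (i # L) h = (T i ^^ Poly_Mapping.lookup \<alpha> i) (A L h)" by (simp add: A_def)
    have i: "i \<in> {1..N}" and IH1: "A L h \<in> ell2"
      and IH2: "\<And>q :: _ \<times> 'm \<Rightarrow> _. q \<in> vpolys N \<Longrightarrow> (\<lambda>x. (\<Prod>i\<leftarrow>L. fst x i ^ Poly_Mapping.lookup \<alpha> i) * q x) \<in> vpolys N"
      and IH3: "\<And>q :: _ \<times> 'm \<Rightarrow> _. q \<in> vpolys N \<Longrightarrow> pairing (A L h) q = of_real r ^ (\<Sum>i\<leftarrow>L. Poly_Mapping.lookup \<alpha> i) *
        pairing h (\<lambda>x. (\<Prod>i\<leftarrow>L. fst x i ^ Poly_Mapping.lookup \<alpha> i) * q x)"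
      using Cons by auto
    have eq: "(\<lambda>x. (\<Prod>i\<leftarrow>i # L. fst x i ^ Poly_Mapping.lookup \<alpha> i) * q x) =
        (\<lambda>x. (\<Prod>i\<leftarrow>L. fst x i ^ Poly_Mapping.lookup \<alpha> i) * (fst x i ^ Poly_Mapping.lookup \<alpha> i * q x))" for q :: "(nat \<Rightarrow> complex) \<times> 'm \<Rightarrow> complex"
      by (intro ext) (simp add: ac_simps)
    show ?case
    proof (intro conjI ballI)
      show "A (i # L) h \<in> ell2" unfolding AC by (rule funpow_T(1)[OF i IH1])
      fix q :: "(nat \<Rightarrow> complex) \<times> 'm \<Rightarrow> complex" assume q: "q \<in> vpolys N"
      have q': "(\<lambda>x. fst x i ^ Poly_Mapping.lookup \<alpha> i * q x) \<in> vpolys N" by (rule funpow_shift_vpolys[OF i q])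
      show "(\<lambda>x. (\<Prod>i\<leftarrow>i # L. fst x i ^ Poly_Mapping.lookup \<alpha> i) * q x) \<in> vpolys N"
        unfolding eq by (rule IH2[OF q'])
      show "pairing (A (i # L) h) q = of_real r ^ (\<Sum>i\<leftarrow>i # L. Poly_Mapping.lookup \<alpha> i) *
        pairing h (\<lambda>x. (\<Prod>i\<leftarrow>i # L. fst x i ^ Poly_Mapping.lookup \<alpha> i) * q x)"
        unfolding eq AC funpow_T(2)[OF i IH1 q] IH3[OF q'] by (simp add: power_add)
    qed
  qed
  have L: "set [1..<Suc N] \<subseteq> {1..N}" by auto
  have op: "monomial_op N T \<alpha> = A [1..<Suc N]" by (simp add: monomial_op_def A_def)
  show "monomial_op N T \<alpha> h \<in> ell2" unfolding op using A[OF L] by blast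
  assume q: "q \<in> vpolys N" and keys: "Poly_Mapping.keys \<alpha> \<subseteq> {1..N}"
  have "(\<Prod>i\<leftarrow>[1..<Suc N]. z i ^ Poly_Mapping.lookup \<alpha> i) = (\<Prod>v\<in>Poly_Mapping.keys \<alpha>. z v ^ Poly_Mapping.lookup \<alpha> v)"
    for z :: "nat \<Rightarrow> complex"
  proof -
    have "(\<Prod>i\<leftarrow>[1..<Suc N]. z i ^ Poly_Mapping.lookup \<alpha> i) = (\<Prod>v\<in>set [1..<Suc N]. z v ^ Poly_Mapping.lookup \<alpha> v)"
      by (rule prod.distinct_set_conv_list[symmetric]) simp
    also have "\<dots> = (\<Prod>v\<in>Poly_Mapping.keys \<alpha>. z v ^ Poly_Mapping.lookup \<alpha> v)"
      using keys by (intro prod.mono_neutral_right) (auto simp: in_keys_iff)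
    finally show ?thesis .
  qed
  then show "pairing (monomial_op N T \<alpha> h) q =
      of_real r ^ (\<Sum>i\<leftarrow>[1..<Suc N]. Poly_Mapping.lookup \<alpha> i) * pairing h (mono_mult \<alpha> q)"
    unfolding op mono_mult_def using A[OF L] q by simp
qed

text \<open>The powers of \<open>r\<close> differ from monomial to monomial, so the sum cannot be
  recombined into \<open>poly_mult f q\<close> yet. That becomes possible at
  \<open>r = 1\<close>.\<close>

lemma poly_op_T:
  assumes "h \<in> ell2"
  shows "poly_op ell2_space N T f h \<in> ell2"
    "q \<in> vpolys N \<Longrightarrow> f \<in> polys_in {1..N} \<Longrightarrow> pairing (poly_op ell2_space N T f h) q =
       (\<Sum>\<alpha>\<in>Poly_Mapping.keys f. of_real r ^ (\<Sum>i\<leftarrow>[1..<Suc N]. Poly_Mapping.lookup \<alpha> i) *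
          (Poly_Mapping.lookup f \<alpha> * pairing h (mono_mult \<alpha> q)))"
proof -
  have eq: "poly_op ell2_space N T f h =
      (\<lambda>k. \<Sum>\<alpha>\<in>Poly_Mapping.keys f. Poly_Mapping.lookup f \<alpha> * monomial_op N T \<alpha> h k)"
    unfolding poly_op_def using assms
    by (subst finsum_ell2_space) (simp_all add: ell2_scale monomial_op_T)
  show "poly_op ell2_space N T f h \<in> ell2"
    unfolding eq by (intro ell2_sum ell2_scale monomial_op_T assms)
  assume q: "q \<in> vpolys N" and f: "f \<in> polys_in {1..N}"
  have "pairing (poly_op ell2_space N T f h) q =
      (\<Sum>\<alpha>\<in>Poly_Mapping.keys f. Poly_Mapping.lookup f \<alpha> * pairing (monomial_op N T \<alpha> h) q)"
    unfolding eq by (simp add: pairing_sum_left pairing_linear_left)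
  also have "\<dots> = (\<Sum>\<alpha>\<in>Poly_Mapping.keys f. of_real r ^ (\<Sum>i\<leftarrow>[1..<Suc N]. Poly_Mapping.lookup \<alpha> i) *
          (Poly_Mapping.lookup f \<alpha> * pairing h (mono_mult \<alpha> q)))"
    using f by (intro sum.cong refl) (simp add: monomial_op_T(2)[OF assms q] polys_in_def)
  finally show "pairing (poly_op ell2_space N T f h) q =
       (\<Sum>\<alpha>\<in>Poly_Mapping.keys f. of_real r ^ (\<Sum>i\<leftarrow>[1..<Suc N]. Poly_Mapping.lookup \<alpha> i) *
          (Poly_Mapping.lookup f \<alpha> * pairing h (mono_mult \<alpha> q)))" .
qed

lemma commuting_strict_contractions_T: "commuting_strict_contractions ell2_space N T"
  unfolding commuting_strict_contractions_def
proof (intro conjI ballI)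
  fix i assume i: "i \<in> {1..N}"
  have lin: "T i (\<lambda>k. h k + g k) = (\<lambda>k. T i h k + T i g k)" "T i (\<lambda>k. c * h k) = (\<lambda>k. c * T i h k)" for h g c
    by (simp_all add: T_def adj_def pairing_linear_left algebra_simps)
  show "linear_operator ell2_space (T i)"
    unfolding linear_operator_def using i by (auto simp: T_ell2 lin)
  have "op_norm (carrier ell2_space) (hnorm ell2_space) (hnorm ell2_space) (T i) \<le> ennreal r"
    unfolding op_norm_def
  proof (rule SUP_least)
    fix h assume "h \<in> {h \<in> carrier ell2_space. hnorm ell2_space h \<le> 1}"
    then have h: "h \<in> ell2" "ell2_norm h \<le> 1" using hnorm_ell2_space by auto
    have "hnorm ell2_space (T i h) = r * ell2_norm (adj (shift i) h)"
      using hnorm_ell2_space[OF T_ell2[OF i h(1)]] r ell2_scale(2)[OF contraction_on.adj_ell2(1)[OF contraction_on_shift[OF i] h(1)], of "of_real r"]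
      by (simp add: T_def)
    also have "\<dots> \<le> r * 1"
      using contraction_on.adj_ell2(2)[OF contraction_on_shift[OF i] h(1)] h(2) r by (intro mult_left_mono) auto
    finally show "ennreal (hnorm ell2_space (T i h)) \<le> ennreal r" by (simp add: ennreal_leI)
  qed
  also have "ennreal r < 1" using r by (simp add: ennreal_less_one_iff)
  finally show "op_norm (carrier ell2_space) (hnorm ell2_space) (hnorm ell2_space) (T i) < 1" .
next
  fix i j h assume ij: "i \<in> {1..N}" "j \<in> {1..N}"
  \<comment> \<open>Transposition reverses the two shifts, and these commute.\<close>
  have "T i (T j h) = (\<lambda>k. of_real r * (of_real r * pairing h (shift j (shift i (gs k)))))" if "i \<in> {1..N}" "j \<in> {1..N}" for i j
    using that by (simp add: T_def[of i] adj_def[of "shift i"] pairing_T vpolys.shift gs_in_V)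
  from this[OF ij] this[OF ij(2,1)] show "T i (T j h) = T j (T i h)" by (simp add: shift_commute)
qed

text \<open>The left side is the sum of the components of \<open>P(T) x\<close>, each evaluated at
  the unit vector with the same index. The squared lengths of the unit vectors add up to 1, so
  Cauchy--Schwarz bounds the sum by the norm of \<open>P(T) x\<close>.\<close>

lemma universal_norm_bound:
  fixes P :: "nat cpoly^'n::finite^'m" and x :: "'n \<Rightarrow> nat \<Rightarrow> complex"
  assumes P: "\<And>i j. P $ i $ j \<in> polys_in {1..N}"
    and x: "\<And>j. x j \<in> ell2" "(\<Sum>j\<in>UNIV. (ell2_norm (x j))\<^sup>2) \<le> 1"
  shows "ennreal (cmod (\<Sum>k\<in>UNIV. \<Sum>j\<in>UNIV. \<Sum>\<alpha>\<in>Poly_Mapping.keys (P $ k $ j).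
      of_real r ^ (\<Sum>i\<leftarrow>[1..<Suc N]. Poly_Mapping.lookup \<alpha> i) *
      (Poly_Mapping.lookup (P $ k $ j) \<alpha> * pairing (x j) (mono_mult \<alpha> (unit_vec k)))))
    \<le> universal_norm TYPE(nat \<Rightarrow> complex) N P"
proof -
  define y where "y = polymat_op ell2_space N T P x"
  have y_eq: "y k = (\<lambda>l. \<Sum>j\<in>UNIV. poly_op ell2_space N T (P $ k $ j) (x j) l)" for k
    unfolding y_def polymat_op_def by (rule finsum_ell2_space) (simp_all add: poly_op_T x)
  have y: "y k \<in> ell2" for k unfolding y_eq by (intro ell2_sum poly_op_T x)
  have pair_y: "pairing (y k) (unit_vec k) = (\<Sum>j\<in>UNIV. \<Sum>\<alpha>\<in>Poly_Mapping.keys (P $ k $ j).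
      of_real r ^ (\<Sum>i\<leftarrow>[1..<Suc N]. Poly_Mapping.lookup \<alpha> i) *
      (Poly_Mapping.lookup (P $ k $ j) \<alpha> * pairing (x j) (mono_mult \<alpha> (unit_vec k))))" for k
    unfolding y_eq pairing_sum_left using P by (intro sum.cong refl poly_op_T vpolys.unit x)
  have "cmod (\<Sum>k\<in>UNIV. pairing (y k) (unit_vec k))
      \<le> (\<Sum>k\<in>UNIV. \<bar>ell2_norm (y k)\<bar> * \<bar>sqrt (Re (F (unit_vec k) (unit_vec k)))\<bar>)"
  proof (rule order_trans[OF norm_sum], rule sum_mono)
    fix k
    have "cmod (pairing (y k) (unit_vec k)) \<le> ell2_norm (y k) * sqrt (Re (F (unit_vec k) (unit_vec k)))"
      by (intro pairing_bound y vpolys.unit)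
    then show "cmod (pairing (y k) (unit_vec k)) \<le> \<bar>ell2_norm (y k)\<bar> * \<bar>sqrt (Re (F (unit_vec k) (unit_vec k)))\<bar>"
      using ell2_norm_nonneg[OF y[of k]] F_nonneg[OF vpolys.unit[of k]] by simp
  qed
  also have "\<dots> \<le> L2_set (\<lambda>k. ell2_norm (y k)) UNIV * L2_set (\<lambda>k. sqrt (Re (F (unit_vec k) (unit_vec k)))) UNIV"
    by (rule L2_set_mult_ineq)
  also have "L2_set (\<lambda>k. sqrt (Re (F (unit_vec k) (unit_vec k)))) UNIV = 1"
    unfolding L2_set_def using F_nonneg[OF vpolys.unit] unit_norm by simp
  also have "L2_set (\<lambda>k. ell2_norm (y k)) UNIV = dsum_norm ell2_space y"
    unfolding L2_set_def dsum_norm_def using y by (simp add: hnorm_ell2_space)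
  finally have "ennreal (cmod (\<Sum>k\<in>UNIV. pairing (y k) (unit_vec k))) \<le> ennreal (dsum_norm ell2_space y)"
    by (intro ennreal_leI) simp
  also have "\<dots> \<le> op_norm (dsum_carrier ell2_space) (dsum_norm ell2_space) (dsum_norm ell2_space) (polymat_op ell2_space N T P)"
    unfolding op_norm_def y_def
  proof (rule SUP_upper)
    have "dsum_norm ell2_space x \<le> 1" using x by (simp add: dsum_norm_def hnorm_ell2_space)
    then show "x \<in> {x \<in> dsum_carrier ell2_space. dsum_norm ell2_space x \<le> 1}"
      using x(1) by (simp add: dsum_carrier_def)
  qed
  also have "\<dots> \<le> universal_norm TYPE(nat \<Rightarrow> complex) N P"
    unfolding universal_norm_def
    using complex_hilbert_space_ell2_space commuting_strict_contractions_T by (intro Sup_upper) blast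
  finally show ?thesis by (simp only: pair_y)
qed

end

text \<open>For fixed \<open>x\<close> the lower bound is the modulus of a polynomial
  \<open>g\<close> in \<open>r\<close>. The value at \<open>r = 1\<close>, where the operators need
  not be strict contractions, is reached by continuity and equals
  \<open>sqrt s \<ge> 1\<close>.\<close>

lemma one_le_universal_norm:
  fixes P :: "nat cpoly^'n::finite^'m::finite"
    and F :: "((nat \<Rightarrow> complex) \<times> 'm \<Rightarrow> complex) \<Rightarrow> ((nat \<Rightarrow> complex) \<times> 'm \<Rightarrow> complex) \<Rightarrow> complex"
  assumes P: "\<And>i j. P $ i $ j \<in> polys_in {1..N}"
    and F: "semi_inner_product fscale (vpolys N) F"
    and contr: "\<And>i p. i \<in> {1..N} \<Longrightarrow> p \<in> vpolys N \<Longrightarrow> Re (F (shift i p) (shift i p)) \<le> Re (F p p)"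
    and unit: "(\<Sum>k\<in>UNIV. Re (F (unit_vec k) (unit_vec k))) = 1"
    and col: "(\<Sum>j\<in>UNIV. Re (F (poly_column P j) (poly_column P j))) \<ge> 1"
  shows "1 \<le> universal_norm TYPE(nat \<Rightarrow> complex) N P"
proof -
  define b where "b = from_nat_into (monomials N :: (_ \<times> 'm \<Rightarrow> _) set)"
  have "range b = monomials N"
    unfolding b_def using unit_vec_monomial[of "undefined :: 'm" N]
    by (intro range_from_nat_into countable_monomials) blast
  then have b: "vpolys N = fs.span (range b)" by (simp add: span_monomials)
  interpret separable_semi_inner_product fscale "vpolys N" F b
    by (intro separable_semi_inner_product.intro F separable_semi_inner_product_axioms.intro b)
  define s where "s = (\<Sum>j\<in>UNIV. Re (F (poly_column P j) (poly_column P j)))"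
  have s: "s \<ge> 1" using col by (simp add: s_def)
  have colV: "poly_column P j \<in> vpolys N" for j by (rule poly_column_vpolys[OF P])
  \<comment> \<open>Normalization: the coordinate sequences of the columns have squared norms with
    sum \<open>s\<close>.\<close>
  define c where "c = complex_of_real (1 / sqrt s)"
  have c: "cmod c = 1 / sqrt s" using s by (simp add: c_def norm_divide)
  define x where "x = (\<lambda>j k. c * coords (poly_column P j) k)"
  have x1: "x j \<in> ell2" for j unfolding x_def by (intro ell2_scale coords_ell2 colV)
  have "(ell2_norm (x j))\<^sup>2 = Re (F (poly_column P j) (poly_column P j)) / s" for j
    using s by (simp add: x_def ell2_scale(2)[OF coords_ell2(1)[OF colV]] power_mult_distrib
      coords_ell2(2)[OF colV] power_divide c)
  then have x2: "(\<Sum>j\<in>UNIV. (ell2_norm (x j))\<^sup>2) \<le> 1"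
    using s by (simp add: sum_divide_distrib[symmetric] s_def[symmetric])
  define g where "g = (\<lambda>r. \<Sum>k\<in>UNIV. \<Sum>j\<in>UNIV. \<Sum>\<alpha>\<in>Poly_Mapping.keys (P $ k $ j).
      complex_of_real r ^ (\<Sum>i\<leftarrow>[1..<Suc N]. Poly_Mapping.lookup \<alpha> i) *
      (Poly_Mapping.lookup (P $ k $ j) \<alpha> * pairing (x j) (mono_mult \<alpha> (unit_vec k))))"
  have bound: "ennreal (cmod (g r)) \<le> universal_norm TYPE(nat \<Rightarrow> complex) N P" if "0 \<le> r" "r < 1" for r
  proof -
    interpret agler_form N F b r
      by unfold_locales (use contr unit that in auto)
    show ?thesis unfolding g_def by (rule universal_norm_bound[OF P x1 x2])
  qed
  have "g 1 = (\<Sum>k\<in>UNIV. \<Sum>j\<in>UNIV. pairing (x j) (poly_mult (P $ k $ j) (unit_vec k)))"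
  proof -
    have "pairing (x j) (poly_mult (P $ k $ j) (unit_vec k)) = (\<Sum>\<alpha>\<in>Poly_Mapping.keys (P $ k $ j).
        Poly_Mapping.lookup (P $ k $ j) \<alpha> * pairing (x j) (mono_mult \<alpha> (unit_vec k)))" for k j
    proof -
      have "mono_mult \<alpha> (unit_vec k) \<in> vpolys N" if "\<alpha> \<in> Poly_Mapping.keys (P $ k $ j)" for \<alpha>
        using P[of k j] that by (intro mono_mult_vpolys vpolys.unit) (auto simp: polys_in_def)
      then show ?thesis
        unfolding poly_mult_eq by (simp add: pairing_sum pairing_scale vpolys.scale)
    qed
    then show ?thesis by (simp add: g_def)
  qed
  also have "\<dots> = (\<Sum>j\<in>UNIV. pairing (x j) (poly_column P j))"
  proof -
    have "pairing (x j) (poly_column P j) = (\<Sum>k\<in>UNIV. pairing (x j) (poly_mult (P $ k $ j) (unit_vec k)))" for j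
      unfolding poly_column_eq by (intro pairing_sum poly_mult_vpolys P vpolys.unit)
    then show ?thesis by (simp only: sum.swap[of _ _ "UNIV :: 'm set"])
  qed
  also have "\<dots> = (\<Sum>j\<in>UNIV. c * of_real (Re (F (poly_column P j) (poly_column P j))))"
    unfolding x_def using F_self[OF colV] by (simp add: pairing_linear_left pairing_coords colV)
  also have "\<dots> = of_real (1 / sqrt s * s)"
    by (simp only: of_real_mult c_def s_def sum_distrib_left of_real_sum)
  also have "1 / sqrt s * s = sqrt s" using s by (simp add: real_div_sqrt)
  finally have g1: "g 1 = of_real (sqrt s)" .
  have "(\<lambda>n. g (1 + - inverse (real (Suc n)))) \<longlonglongrightarrow> g 1"
    unfolding g_def by (intro tendsto_intros LIMSEQ_inverse_real_of_nat_add_minus)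
  then have lim: "(\<lambda>n. ennreal (cmod (g (1 + - inverse (real (Suc n)))))) \<longlonglongrightarrow> ennreal (cmod (g 1))"
    by (intro tendsto_intros)
  have "ennreal (cmod (g 1)) \<le> universal_norm TYPE(nat \<Rightarrow> complex) N P"
  proof (rule LIMSEQ_le_const2[OF lim], intro exI allI impI)
    fix n
    \<comment> \<open>At \<open>n = 0\<close> the parameter is 0, which \<open>bound\<close>
      admits.\<close>
    have "inverse (real (Suc n)) \<le> 1" "inverse (real (Suc n)) > 0" by (simp_all add: field_simps)
    then show "ennreal (cmod (g (1 + - inverse (real (Suc n))))) \<le> universal_norm TYPE(nat \<Rightarrow> complex) N P"
      by (intro bound) simp_all
  qed
  moreover have "1 \<le> ennreal (cmod (g 1))" using s by (simp add: g1)
  ultimately show ?thesis by (rule order_trans[rotated])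
qed


subsection \<open>Polynomial kernels\<close>

definition mono_val :: "('v \<Rightarrow>\<^sub>0 nat) \<Rightarrow> ('v \<Rightarrow> complex) \<Rightarrow> complex" where
  "mono_val \<alpha> z = (\<Prod>v\<in>Poly_Mapping.keys \<alpha>. z v ^ Poly_Mapping.lookup \<alpha> v)"

lemma mono_val_superset:
  "finite S \<Longrightarrow> Poly_Mapping.keys \<alpha> \<subseteq> S \<Longrightarrow> mono_val \<alpha> z = (\<Prod>v\<in>S. z v ^ Poly_Mapping.lookup \<alpha> v)"
  unfolding mono_val_def by (rule prod.mono_neutral_left) (simp_all add: in_keys_iff)

lemma eval_poly_superset:
  "finite S \<Longrightarrow> Poly_Mapping.keys p \<subseteq> S \<Longrightarrow> eval_poly p z = (\<Sum>\<alpha>\<in>S. Poly_Mapping.lookup p \<alpha> * mono_val \<alpha> z)"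
  unfolding eval_poly_def mono_val_def[symmetric] by (rule sum.mono_neutral_left) (simp_all add: in_keys_iff)

lemma eval_poly_add: "eval_poly (p + q) z = eval_poly p z + eval_poly q z"
proof -
  define S where "S = Poly_Mapping.keys p \<union> Poly_Mapping.keys q"
  have S: "finite S" "Poly_Mapping.keys p \<subseteq> S" "Poly_Mapping.keys q \<subseteq> S" "Poly_Mapping.keys (p + q) \<subseteq> S"
    using Poly_Mapping.keys_add[of p q] by (auto simp: S_def)
  show ?thesis
    unfolding eval_poly_superset[OF S(1,2)] eval_poly_superset[OF S(1,3)] eval_poly_superset[OF S(1,4)]
    by (simp add: lookup_add algebra_simps sum.distrib)
qed

lemma eval_poly_0: "eval_poly 0 z = 0"
  by (simp add: eval_poly_def)

lemma eval_poly_sum: "eval_poly (\<Sum>a\<in>A. f a) z = (\<Sum>a\<in>A. eval_poly (f a) z)"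
  by (induction A rule: infinite_finite_induct) (simp_all add: eval_poly_0 eval_poly_add)

lemma eval_poly_single: "eval_poly (Poly_Mapping.single \<alpha> c) z = c * mono_val \<alpha> z"
  using eval_poly_superset[of "{\<alpha>}" "Poly_Mapping.single \<alpha> c" z] by simp

lemma mono_val_add_single: "mono_val (\<alpha> + Poly_Mapping.single v 1) z = z v * mono_val \<alpha> z"
proof -
  define S where "S = insert v (Poly_Mapping.keys \<alpha>)"
  have S: "finite S" "Poly_Mapping.keys \<alpha> \<subseteq> S" "Poly_Mapping.keys (\<alpha> + Poly_Mapping.single v 1) \<subseteq> S" "v \<in> S"
    using Poly_Mapping.keys_add[of \<alpha> "Poly_Mapping.single v 1"] by (auto simp: S_def split: if_splits)
  have "(\<Prod>w\<in>S. z w ^ Poly_Mapping.lookup (Poly_Mapping.single v 1) w) = (\<Prod>w\<in>S. if w = v then z v else 1)"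
    by (intro prod.cong) (auto simp: lookup_single)
  also have "\<dots> = z v" using S by simp
  finally show ?thesis
    unfolding mono_val_superset[OF S(1,2)] mono_val_superset[OF S(1,3)]
    by (simp add: lookup_add power_add prod.distrib)
qed

lemma polys_in_add: "p \<in> polys_in V \<Longrightarrow> q \<in> polys_in V \<Longrightarrow> p + q \<in> polys_in V"
  using Poly_Mapping.keys_add[of p q] by (auto simp: polys_in_def)

lemma polys_in_sum: "(\<And>a. a \<in> A \<Longrightarrow> f a \<in> polys_in V) \<Longrightarrow> (\<Sum>a\<in>A. f a) \<in> polys_in V"
  by (induction A rule: infinite_finite_induct) (simp_all add: polys_in_add, simp_all add: polys_in_def)

lemma polys_in_single: "Poly_Mapping.keys \<alpha> \<subseteq> V \<Longrightarrow> Poly_Mapping.single \<alpha> c \<in> polys_in V"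
  by (simp add: polys_in_def)

text \<open>Closure under sums, scalars and multiplication by one variable is enough here, since
  \<open>vpolys\<close> is generated by these operations. A general product of polynomials is never
  formed.\<close>

definition poly_kernels :: "nat \<Rightarrow> ((nat \<Rightarrow> complex) \<Rightarrow> (nat \<Rightarrow> complex) \<Rightarrow> complex) set" where
  "poly_kernels N = {g. \<exists>q\<in>polys_in ({1..N} <+> {1..N}). \<forall>z w. g z w = eval_poly q (case_sum z (\<lambda>i. cnj (w i)))}"

lemma poly_kernels_const: "(\<lambda>z w. c) \<in> poly_kernels N"
  unfolding poly_kernels_def
  by (intro CollectI bexI[of _ "Poly_Mapping.single 0 c"] polys_in_single)
    (simp_all add: eval_poly_single mono_val_def)

lemma poly_kernels_add:
  assumes "g \<in> poly_kernels N" "h \<in> poly_kernels N"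
  shows "(\<lambda>z w. g z w + h z w) \<in> poly_kernels N"
proof -
  obtain p q where "p \<in> polys_in ({1..N} <+> {1..N})" "\<And>z w. g z w = eval_poly p (case_sum z (\<lambda>i. cnj (w i)))"
    "q \<in> polys_in ({1..N} <+> {1..N})" "\<And>z w. h z w = eval_poly q (case_sum z (\<lambda>i. cnj (w i)))"
    using assms unfolding poly_kernels_def by blast
  then show ?thesis
    unfolding poly_kernels_def by (intro CollectI bexI[of _ "p + q"] polys_in_add) (simp_all add: eval_poly_add)
qed

lemma poly_kernels_mult_var:
  assumes "g \<in> poly_kernels N" "v \<in> {1..N} <+> {1..N}"
  shows "(\<lambda>z w. case_sum z (\<lambda>i. cnj (w i)) v * g z w) \<in> poly_kernels N"
proof -
  obtain p where p: "p \<in> polys_in ({1..N} <+> {1..N})" "\<And>z w. g z w = eval_poly p (case_sum z (\<lambda>i. cnj (w i)))"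
    using assms unfolding poly_kernels_def by blast
  define q where "q = (\<Sum>\<alpha>\<in>Poly_Mapping.keys p. Poly_Mapping.single (\<alpha> + Poly_Mapping.single v 1) (Poly_Mapping.lookup p \<alpha>))"
  have "q \<in> polys_in ({1..N} <+> {1..N})"
    unfolding q_def
  proof (intro polys_in_sum polys_in_single)
    fix \<alpha> assume "\<alpha> \<in> Poly_Mapping.keys p"
    then have "Poly_Mapping.keys \<alpha> \<subseteq> {1..N} <+> {1..N}" using p(1) by (simp add: polys_in_def)
    then show "Poly_Mapping.keys (\<alpha> + Poly_Mapping.single v 1) \<subseteq> {1..N} <+> {1..N}"
      using Poly_Mapping.keys_add[of \<alpha> "Poly_Mapping.single v 1"] assms(2) by (auto split: if_splits)
  qed
  moreover have "eval_poly q \<zeta> = \<zeta> v * eval_poly p \<zeta>" for \<zeta>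
  proof -
    have "eval_poly q \<zeta> = (\<Sum>\<alpha>\<in>Poly_Mapping.keys p. Poly_Mapping.lookup p \<alpha> * (\<zeta> v * mono_val \<alpha> \<zeta>))"
      unfolding q_def eval_poly_sum eval_poly_single mono_val_add_single ..
    also have "\<dots> = \<zeta> v * eval_poly p \<zeta>"
      unfolding eval_poly_def mono_val_def[symmetric] sum_distrib_left by (intro sum.cong) (simp_all add: ac_simps)
    finally show ?thesis .
  qed
  ultimately show ?thesis unfolding poly_kernels_def using p(2) by (intro CollectI bexI[of _ q]) simp_all
qed

lemma poly_kernels_scale:
  assumes "g \<in> poly_kernels N"
  shows "(\<lambda>z w. c * g z w) \<in> poly_kernels N"
proof -
  obtain p where p: "p \<in> polys_in ({1..N} <+> {1..N})" "\<And>z w. g z w = eval_poly p (case_sum z (\<lambda>i. cnj (w i)))"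
    using assms unfolding poly_kernels_def by blast
  define q where "q = (\<Sum>\<alpha>\<in>Poly_Mapping.keys p. Poly_Mapping.single \<alpha> (c * Poly_Mapping.lookup p \<alpha>))"
  have "q \<in> polys_in ({1..N} <+> {1..N})"
    unfolding q_def using p(1) by (intro polys_in_sum polys_in_single) (simp add: polys_in_def)
  moreover have "eval_poly q \<zeta> = c * eval_poly p \<zeta>" for \<zeta>
    unfolding q_def eval_poly_sum eval_poly_single
    by (simp add: eval_poly_def mono_val_def sum_distrib_left mult.assoc)
  ultimately show ?thesis unfolding poly_kernels_def using p(2) by (intro CollectI bexI[of _ q]) simp_all
qed

text \<open>Induction on \<open>p\<close> with \<open>g\<close> fixed. Taking for \<open>g\<close> a
  conjugated component of \<open>p\<close> in the second point yields the entries of a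
  square.\<close>

lemma poly_kernels_mult:
  assumes "p \<in> vpolys N" "g \<in> poly_kernels N"
  shows "(\<lambda>z w. p (z, k) * g z w) \<in> poly_kernels N"
  using assms(1)
proof (induction p rule: vpolys.induct)
  case (unit l)
  show ?case using assms(2) poly_kernels_const[of 0] by (cases "k = l") (simp_all add: unit_vec_def)
next
  case (add p q)
  then show ?case using poly_kernels_add by (simp add: plus_fun_apply distrib_right)
next
  case (scale p c)
  then show ?case using poly_kernels_scale[of _ N c] by (simp add: fscale_def mult.assoc)
next
  case (shift p i)
  then show ?case using poly_kernels_mult_var[of _ N "Inl i"] by (simp add: shift_def mult.assoc InlI)
qed

lemma poly_kernels_cnj:
  assumes "p \<in> vpolys N"
  shows "(\<lambda>z w. cnj (p (w, l))) \<in> poly_kernels N"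
  using assms
proof (induction p rule: vpolys.induct)
  case (unit k)
  show ?case using poly_kernels_const[of 0] poly_kernels_const[of 1]
    by (cases "l = k") (simp_all add: unit_vec_def)
next
  case (add p q)
  then show ?case using poly_kernels_add by (simp add: plus_fun_apply)
next
  case (scale p c)
  then show ?case using poly_kernels_scale[of _ N "cnj c"] by (simp add: fscale_def)
next
  case (shift p i)
  then show ?case using poly_kernels_mult_var[of _ N "Inr i"] by (simp add: shift_def InrI)
qed

lemma sos_poly_kernel:
  assumes "h \<in> sos N"
  shows "(\<lambda>z w. h (z, k) (w, l)) \<in> poly_kernels N"
  using assms
proof (induction h rule: sos.induct)
  case zero
  then show ?case using poly_kernels_const[of 0] by (simp add: zero_fun_apply)
next
  case (add_square h p)
  have "(\<lambda>z w. p (z, k) * cnj (p (w, l))) \<in> poly_kernels N"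
    by (intro poly_kernels_mult poly_kernels_cnj add_square.hyps)
  with add_square.IH show ?case
    using poly_kernels_add by (simp add: plus_fun_apply outer_def)
qed

text \<open>The quadratic form of a single square is the squared modulus of the linear form
  \<open>a\<close>. The map \<open>f\<close> will send the index of a block matrix entry to a point
  together with a component.\<close>

lemma sos_pos_semidef:
  assumes "h \<in> sos N"
  shows "pos_semidef_on I (\<lambda>i j. h (f i) (f j))"
  using assms
proof (induction h rule: sos.induct)
  case zero
  then show ?case by (simp add: pos_semidef_on_def zero_fun_apply)
next
  case (add_square h p)
  show ?case
    unfolding pos_semidef_on_def
  proof
    fix v
    define a where "a = (\<Sum>i\<in>I. cnj (v i) * p (f i))"
    have "(\<Sum>i\<in>I. \<Sum>j\<in>I. cnj (v i) * outer p p (f i) (f j) * v j) = a * cnj a"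
      unfolding a_def cnj_sum sum_product by (intro sum.cong) (simp_all add: outer_def ac_simps)
    also have "\<dots> = of_real ((cmod a)\<^sup>2)" by (rule complex_norm_square[symmetric])
    also have "\<dots> \<in> \<real>\<^sub>\<ge>\<^sub>0" by (subst nonneg_Reals_of_real_iff) simp
    finally have "(\<Sum>i\<in>I. \<Sum>j\<in>I. cnj (v i) * outer p p (f i) (f j) * v j) \<in> \<real>\<^sub>\<ge>\<^sub>0" .
    moreover have "(\<Sum>i\<in>I. \<Sum>j\<in>I. cnj (v i) * h (f i) (f j) * v j) \<in> \<real>\<^sub>\<ge>\<^sub>0"
      using add_square.IH by (simp add: pos_semidef_on_def)
    ultimately have "(\<Sum>i\<in>I. \<Sum>j\<in>I. cnj (v i) * h (f i) (f j) * v j) +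
        (\<Sum>i\<in>I. \<Sum>j\<in>I. cnj (v i) * outer p p (f i) (f j) * v j) \<in> \<real>\<^sub>\<ge>\<^sub>0"
      by (intro nonneg_Reals_add_I)
    then show "(\<Sum>i\<in>I. \<Sum>j\<in>I. cnj (v i) * (h + outer p p) (f i) (f j) * v j) \<in> \<real>\<^sub>\<ge>\<^sub>0"
      by (simp add: plus_fun_apply distrib_left distrib_right sum.distrib)
  qed
qed

definition kernel_matrix :: "((nat \<Rightarrow> complex) \<times> 'm \<Rightarrow> (nat \<Rightarrow> complex) \<times> 'm \<Rightarrow> complex) \<Rightarrow>
    (nat \<Rightarrow> complex) \<Rightarrow> (nat \<Rightarrow> complex) \<Rightarrow> complex^'m^'m" where
  "kernel_matrix h z w = (\<chi> k l. h (z, k) (w, l))"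

theorem corollary2:
  fixes N :: nat and P :: "nat cpoly^'n::finite^'m::finite"
  assumes "N \<ge> 1"
    and "\<And>i j. P $ i $ j \<in> polys_in {1..N}"
    and "universal_norm TYPE(nat \<Rightarrow> complex) N P < 1"
  shows "\<exists>K :: nat \<Rightarrow> (nat \<Rightarrow> complex) \<Rightarrow> (nat \<Rightarrow> complex) \<Rightarrow> complex^'m^'m.
    (\<forall>i\<in>{0..N}. positive_definite_kernel N (K i) \<and> polynomial_kernel N (K i)) \<and>
    (\<forall>z\<in>polydisc N. \<forall>w\<in>polydisc N.
      mat 1 - eval_mat P z ** adjoint_mat (eval_mat P w) =
      K 0 z w + (\<Sum>i=1..N. map_matrix ((*) (1 - z i * cnj (w i))) (K i z w)))"
proof -
  \<comment> \<open>The entries of \<open>P(z)\<close> times the adjoint of \<open>P(w)\<close> are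
    sums over the columns, so this kernel is the left side of the claimed identity, and its
    membership in the cone is the identity read entrywise.\<close>
  have "unit_kernel - (\<Sum>j\<in>UNIV. outer (poly_column P j) (poly_column P j)) \<in> agler_cone N"
  proof (rule ccontr)
    assume "\<not> ?thesis"
    then have "1 \<le> universal_norm TYPE(nat \<Rightarrow> complex) N P"
    proof (rule separating_form[OF poly_column_vpolys[OF assms(2)]])
    qed (rule one_le_universal_norm[OF assms(2)])
    then show False using assms(3) by simp
  qed
  then obtain K where K: "\<And>i. K i \<in> sos N"
    and eq: "unit_kernel - (\<Sum>j\<in>UNIV. outer (poly_column P j) (poly_column P j)) = K 0 + (\<Sum>i=1..N. defect i (K i))"
    by (auto simp: agler_cone_def)
  have "positive_definite_kernel N (kernel_matrix (K i))" for i
    unfolding positive_definite_kernel_def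
  proof (intro allI impI)
    fix r and z :: "nat \<Rightarrow> nat \<Rightarrow> complex"
    show "pos_semidef_on ({..<r} \<times> UNIV) (\<lambda>(a, k) (b, l). kernel_matrix (K i) (z a) (z b) $ k $ l)"
      using sos_pos_semidef[OF K, of "{..<r} \<times> UNIV" i "\<lambda>(a, k). (z a, k)"]
      by (simp add: kernel_matrix_def case_prod_unfold)
  qed
  moreover have "polynomial_kernel N (kernel_matrix (K i))" for i
    unfolding polynomial_kernel_def
  proof (intro allI)
    fix k l
    show "\<exists>q\<in>polys_in ({1..N} <+> {1..N}). \<forall>z\<in>polydisc N. \<forall>w\<in>polydisc N.
        kernel_matrix (K i) z w $ k $ l = eval_poly q (case_sum z (\<lambda>i. cnj (w i)))"
      using sos_poly_kernel[OF K[of i], where k=k and l=l] unfolding poly_kernels_def kernel_matrix_def by auto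
  qed
  moreover have "mat 1 - eval_mat P z ** adjoint_mat (eval_mat P w) =
      kernel_matrix (K 0) z w + (\<Sum>i=1..N. map_matrix ((*) (1 - z i * cnj (w i))) (kernel_matrix (K i) z w))" for z w
  proof -
    have "(mat 1 - eval_mat P z ** adjoint_mat (eval_mat P w)) $ k $ l =
      (kernel_matrix (K 0) z w + (\<Sum>i=1..N. map_matrix ((*) (1 - z i * cnj (w i))) (kernel_matrix (K i) z w))) $ k $ l" for k l
    proof -
      have "(unit_kernel :: _ \<times> 'm \<Rightarrow> _) (z, k) (w, l) = (\<Sum>i\<in>UNIV. if i = k then mat 1 $ k $ l else 0)"
        unfolding unit_kernel_def sum_fun_apply by (intro sum.cong) (auto simp: outer_def unit_vec_def mat_def)
      then have "(unit_kernel - (\<Sum>j\<in>UNIV. outer (poly_column P j) (poly_column P j))) (z, k) (w, l) =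
          (mat 1 - eval_mat P z ** adjoint_mat (eval_mat P w)) $ k $ l"
        by (simp add: minus_apply sum_fun_apply outer_def poly_column_def matrix_matrix_mult_def eval_mat_def
            adjoint_mat_def map_matrix_def transpose_def)
      moreover have "(K 0 + (\<Sum>i=1..N. defect i (K i))) (z, k) (w, l) =
          (kernel_matrix (K 0) z w + (\<Sum>i=1..N. map_matrix ((*) (1 - z i * cnj (w i))) (kernel_matrix (K i) z w))) $ k $ l"
        by (simp add: plus_fun_apply sum_fun_apply defect_def kernel_matrix_def map_matrix_def)
      ultimately show ?thesis unfolding eq by simp
    qed
    then show ?thesis by (simp add: vec_eq_iff)
  qed
  ultimately show ?thesis by (intro exI[of _ "\<lambda>i. kernel_matrix (K i)"]) blast
qed

end
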